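(* Suppose that $G$ is a separable topological group, $X$ is a Polish space, $G \curvearrowright X$ is a continuous action, and $\mathcal{S}$ is the family of sets of the form $\bigcup_{n \in \mathbb{N}} S_n^{-1}S_n \setminus \{1_G\}$, where $S_n \subseteq G$ has cardinality $n$ for all $n \in \mathbb{N}$. Then the following are equivalent: (1) There exists $S \in \mathcal{S}$ for which the family $\mathcal{F}_S$ is not in the recurrence spectrum of $G \curvearrowright X$. (2) There exist sets $S_n \subseteq G$ of cardinality $n$ (for $n \in \mathbb{N}$) and a smooth $\aleph_0$-universally-Baire superequivalence relation $F$ of $E_G^X$ such that for every $x \in X$, the action $G \curvearrowright [x]_F$ has a $\sigma$-complete $\aleph_0$-universally-Baire set that is $S_n$-wandering for all $n \in \mathbb{N}$. (3) The action $G \curvearrowright X$ has a very-weakly-wandering $\sigma$-complete $\mathbf{\Sigma}^0_2$ set.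
   Context: $E_G^X$ is the orbit equivalence relation of $G \curvearrowright X$. A superequivalence relation of an equivalence relation $E$ is an equivalence relation containing $E$; each class $C$ of a superequivalence relation of $E_G^X$ is $G$-invariant, so $G$ acts on $C$. $[x]_F$ is the $F$-class of $x$. For an action $G \curvearrowright Z$, a set $Y \subseteq Z$ is $\sigma$-complete if there is a countable set $H \subseteq G$ with $Z = HY$; it is $S$-wandering (for $S \subseteq G$) if $gY \cap hY = \emptyset$ for all distinct $g,h \in S$; it is very weakly wandering if there are arbitrarily large finite sets $S \subseteq G$ for which $Y$ is $S$-wandering. Let $\Delta(Y) = \{g \in G \mid Y \cap gY \neq \emptyset\}$. For $S \subseteq G$, $\mathcal{F}_S = \{T \subseteq G \mid S \cap T \neq \emptyset\}$. A subset of a Borel (or topological) space $Z$ is $\aleph_0$-universally Baire if its preimage under every Borel function from a Polish space to $Z$ has the Baire property. An $\aleph_0$-universally-Baire equivalence relation $E$ on $Z$ (i.e., $E$ is an $\aleph_0$-universally-Baire subset of $Z \times Z$) is smooth if there is no Borel function $\pi \colon 2^{\mathbb{N}} \to Z$ such that $c \mathrel{\mathbb{E}_0} d \iff \pi(c) \mathrel{E} \pi(d)$ for all $c,d \in 2^{\mathbb{N}}$, where $c \mathrel{\mathbb{E}_0} d \iff \exists n\, \forall m \ge n\ c(m) = d(m)$. For Borel equivalence relations on standard Borel spaces this agrees with the usual notion: there is a Borel $\pi$ into a standard Borel space with $x \mathrel{E} y \iff \pi(x)=\pi(y)$. For an upward-closed family $\mathcal{F} \subseteq \mathcal{P}(G)$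 and $\Gamma \subseteq \mathcal{P}(Z)$, the action $G \curvearrowright Z$ is $\mathcal{F}$-recurrent on $\Gamma$ if $\Delta(B) \in \mathcal{F}$ for all $B \in \Gamma$. The recurrence spectrum of $G \curvearrowright X$ is the collection of all upward-closed families $\mathcal{F} \subseteq \mathcal{P}(G)$ such that every smooth Borel superequivalence relation $F$ of $E_G^X$ has an equivalence class $C$ for which $G \curvearrowright C$ is $\mathcal{F}$-recurrent on $\sigma$-complete Borel sets. $\mathbf{\Sigma}^0_2$ sets are countable unions of closed sets. *)

theory Defs
  imports "HOL-Analysis.Analysis" "HOL-Algebra.Group_Action"
begin

subsection \<open>Descriptive set theory\<close>

definition polish_topology :: "'a topology \<Rightarrow> bool" where
  "polish_topology X \<longleftrightarrow> separable_space X \<and> completely_metrizable_space X"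

definition borel_of :: "'a topology \<Rightarrow> 'a measure" where
  "borel_of X = sigma (topspace X) {U. openin X U}"

definition nowhere_dense_in :: "'a topology \<Rightarrow> 'a set \<Rightarrow> bool" where
  "nowhere_dense_in X A \<longleftrightarrow> A \<subseteq> topspace X \<and> X interior_of (X closure_of A) = {}"

definition meager_in :: "'a topology \<Rightarrow> 'a set \<Rightarrow> bool" where
  "meager_in X A \<longleftrightarrow> (\<exists>N :: nat \<Rightarrow> 'a set. (\<forall>n. nowhere_dense_in X (N n)) \<and> A = (\<Union>n. N n))"

definition Baire_property_in :: "'a topology \<Rightarrow> 'a set \<Rightarrow> bool" where
  "Baire_property_in X A \<longleftrightarrow>
     A \<subseteq> topspace X \<and> (\<exists>U. openin X U \<and> meager_in X ((A - U) \<union> (U - A)))"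

text \<open>
  HOL cannot quantify over all types inside a definition, so the test spaces below are the Polish
  topologies whose underlying set is a set of reals. Up to homeomorphism these are all the
  Polish spaces; see \<open>polish_topology_homeomorphic_real\<close>.
\<close>

definition aleph0_universally_Baire :: "'a topology \<Rightarrow> 'a set \<Rightarrow> bool" where
  "aleph0_universally_Baire Z A \<longleftrightarrow>
     A \<subseteq> topspace Z \<and>
     (\<forall>W :: real topology. polish_topology W \<longrightarrow>
       (\<forall>f \<in> measurable (borel_of W) (borel_of Z). Baire_property_in W (f -` A \<inter> topspace W)))"

lemma polish_topology_homeomorphic_real:
  fixes X :: "'a topology"
  assumes X: "polish_topology X"
  shows "\<exists>W :: real topology. polish_topology W \<and> X homeomorphic_space W"
proof -
  obtain C where C: "countable C" "C \<subseteq> topspace X" "X closure_of C = topspace X"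
    using X by (auto simp: polish_topology_def separable_space_def)
  obtain M d where Md: "Metric_space M d" "X = Metric_space.mtopology M d"
    using X by (auto simp: polish_topology_def completely_metrizable_space_def)
  interpret Metric_space M d by (rule Md(1))
  have tX: "topspace X = M" by (simp add: Md(2))
  define \<B> where "\<B> = (\<lambda>(c, n). mball c (inverse (Suc n))) ` (C \<times> (UNIV :: nat set))"
  have cB: "countable \<B>"
    unfolding \<B>_def using C(1) by blast
  have sep: "\<exists>V \<in> \<B>. x \<in> V \<and> y \<notin> V" if xy: "x \<in> M" "y \<in> M" "x \<noteq> y" for x y
  proof -
    have "0 < d x y / 2" using xy by simp
    then obtain n where n: "inverse (real (Suc n)) < d x y / 2"
      using reals_Archimedean by blast
    have "x \<in> mtopology closure_of C" using C(3) tX Md(2) xy by simp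
    moreover have "0 < inverse (real (Suc n))" by simp
    ultimately obtain c where c: "c \<in> C" "c \<in> mball x (inverse (Suc n))"
      unfolding metric_closure_of by blast
    then have cM: "c \<in> M" and dx: "d x c < inverse (Suc n)" by auto
    have "d x y \<le> d x c + d c y" using triangle xy cM by blast
    then have "\<not> d c y < inverse (Suc n)" using dx n by linarith
    then have "x \<in> mball c (inverse (Suc n))" "y \<notin> mball c (inverse (Suc n))"
      using dx cM xy commute by auto
    then show ?thesis using c(1) unfolding \<B>_def by blast
  qed
  define e where "e = (\<lambda>x. to_nat_on \<B> ` {V \<in> \<B>. x \<in> V})"
  have inj_e: "inj_on e (topspace X)"
  proof (rule inj_onI, rule ccontr)
    fix x y assume xy: "x \<in> topspace X" "y \<in> topspace X" "e x = e y" "x \<noteq> y"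
    have "{V \<in> \<B>. x \<in> V} = {V \<in> \<B>. y \<in> V}"
      using xy(3) inj_on_to_nat_on[OF cB] unfolding e_def
      by (subst (asm) inj_on_image_eq_iff[of _ \<B>]) auto
    then show False using sep[of x y] xy tX by blast
  qed
  have "(UNIV :: nat set set) \<approx> (UNIV :: real set)"
    by (rule nat_sets_eqpoll_reals)
  then obtain h :: "nat set \<Rightarrow> real" where "bij h"
    unfolding eqpoll_def by blast
  define f where "f = h \<circ> e"
  have inj_f: "inj_on f (topspace X)"
    using inj_e \<open>bij h\<close> unfolding f_def by (simp add: bij_def comp_inj_on inj_on_def)
  define g where "g = inv_into (topspace X) f"
  define W where "W = pullback_topology (f ` topspace X) g X"
  have gf: "\<And>x. x \<in> topspace X \<Longrightarrow> g (f x) = x"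
    unfolding g_def using inj_f by simp
  have tW: "topspace W = f ` topspace X"
    unfolding W_def topspace_pullback_topology using gf by auto
  have "homeomorphic_maps X W f g"
    unfolding homeomorphic_maps_def
  proof (intro conjI)
    show "continuous_map X W f"
      unfolding W_def
      by (rule continuous_map_pullback') (use gf in \<open>auto intro: continuous_map_eq[OF continuous_map_id]\<close>)
    show "continuous_map W X g"
      unfolding W_def using continuous_map_pullback[OF continuous_map_id, of "f ` topspace X" g X]
      by simp
  qed (use gf tW in auto)
  then have hom: "X homeomorphic_space W"
    unfolding homeomorphic_space_def by blast
  then have "polish_topology W"
    using X homeomorphic_separable_space homeomorphic_completely_metrizable_space
    unfolding polish_topology_def by blast
  with hom show ?thesis by blast
qed

definition cantor_space :: "(nat \<Rightarrow> bool) topology" where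
  "cantor_space = product_topology (\<lambda>_. discrete_topology UNIV) UNIV"

definition E0 :: "(nat \<Rightarrow> bool) rel" where
  "E0 = {(c, d). \<exists>n. \<forall>m\<ge>n. c m = d m}"

definition smooth_rel :: "'a topology \<Rightarrow> 'a rel \<Rightarrow> bool" where
  "smooth_rel Z E \<longleftrightarrow>
     \<not> (\<exists>\<pi> \<in> measurable (borel_of cantor_space) (borel_of Z). \<forall>c d. (c, d) \<in> E0 \<longleftrightarrow> (\<pi> c, \<pi> d) \<in> E)"

subsection \<open>Continuous actions\<close>

definition topological_group :: "('g, 'm) monoid_scheme \<Rightarrow> 'g topology \<Rightarrow> bool" where
  "topological_group G T \<longleftrightarrow>
     group G \<and> topspace T = carrier G \<and>
     continuous_map (prod_topology T T) T (\<lambda>(g, h). g \<otimes>\<^bsub>G\<^esub> h) \<and>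
     continuous_map T T (\<lambda>g. inv\<^bsub>G\<^esub> g)"

definition continuous_action ::
  "('g, 'm) monoid_scheme \<Rightarrow> 'g topology \<Rightarrow> 'x topology \<Rightarrow> ('g \<Rightarrow> 'x \<Rightarrow> 'x) \<Rightarrow> bool" where
  "continuous_action G T X \<phi> \<longleftrightarrow>
     group_action G (topspace X) \<phi> \<and>
     continuous_map (prod_topology T X) X (\<lambda>(g, x). \<phi> g x)"

definition orbit_rel :: "('g, 'm) monoid_scheme \<Rightarrow> 'x set \<Rightarrow> ('g \<Rightarrow> 'x \<Rightarrow> 'x) \<Rightarrow> 'x rel" where
  "orbit_rel G Z \<phi> = {(x, y). x \<in> Z \<and> y \<in> orbit G \<phi> x}"

definition superequivalence :: "('g, 'm) monoid_scheme \<Rightarrow> 'x set \<Rightarrow> ('g \<Rightarrow> 'x \<Rightarrow> 'x) \<Rightarrow> 'x rel \<Rightarrow> bool" where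
  "superequivalence G Z \<phi> F \<longleftrightarrow> equiv Z F \<and> orbit_rel G Z \<phi> \<subseteq> F"

text \<open>
  The action on an invariant set \<open>C\<close> is given by the same \<open>\<phi>\<close>; only \<open>\<sigma>\<close>-completeness depends on
  the set being acted on.
\<close>

definition sigma_complete ::
  "('g, 'm) monoid_scheme \<Rightarrow> ('g \<Rightarrow> 'x \<Rightarrow> 'x) \<Rightarrow> 'x set \<Rightarrow> 'x set \<Rightarrow> bool" where
  "sigma_complete G \<phi> Z Y \<longleftrightarrow>
     Y \<subseteq> Z \<and> (\<exists>H \<subseteq> carrier G. countable H \<and> Z = (\<Union>h\<in>H. \<phi> h ` Y))"

definition wandering :: "('g \<Rightarrow> 'x \<Rightarrow> 'x) \<Rightarrow> 'g set \<Rightarrow> 'x set \<Rightarrow> bool" where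
  "wandering \<phi> S Y \<longleftrightarrow> (\<forall>g\<in>S. \<forall>h\<in>S. g \<noteq> h \<longrightarrow> \<phi> g ` Y \<inter> \<phi> h ` Y = {})"

definition very_weakly_wandering ::
  "('g, 'm) monoid_scheme \<Rightarrow> ('g \<Rightarrow> 'x \<Rightarrow> 'x) \<Rightarrow> 'x set \<Rightarrow> bool" where
  "very_weakly_wandering G \<phi> Y \<longleftrightarrow>
     (\<forall>n. \<exists>S \<subseteq> carrier G. finite S \<and> n \<le> card S \<and> wandering \<phi> S Y)"

subsection \<open>Recurrence\<close>

definition Delta :: "('g, 'm) monoid_scheme \<Rightarrow> ('g \<Rightarrow> 'x \<Rightarrow> 'x) \<Rightarrow> 'x set \<Rightarrow> 'g set" where
  "Delta G \<phi> Y = {g \<in> carrier G. Y \<inter> \<phi> g ` Y \<noteq> {}}"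

definition hitting_family :: "('g, 'm) monoid_scheme \<Rightarrow> 'g set \<Rightarrow> 'g set set" where
  "hitting_family G S = {T. T \<subseteq> carrier G \<and> S \<inter> T \<noteq> {}}"

definition upward_closed_family :: "('g, 'm) monoid_scheme \<Rightarrow> 'g set set \<Rightarrow> bool" where
  "upward_closed_family G \<F> \<longleftrightarrow>
     \<F> \<subseteq> Pow (carrier G) \<and> (\<forall>A\<in>\<F>. \<forall>B. A \<subseteq> B \<and> B \<subseteq> carrier G \<longrightarrow> B \<in> \<F>)"

definition recurrent_on ::
  "('g, 'm) monoid_scheme \<Rightarrow> ('g \<Rightarrow> 'x \<Rightarrow> 'x) \<Rightarrow> 'g set set \<Rightarrow> 'x set set \<Rightarrow> bool" where
  "recurrent_on G \<phi> \<F> \<Gamma> \<longleftrightarrow> (\<forall>B\<in>\<Gamma>. Delta G \<phi> B \<in> \<F>)"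

definition recurrence_spectrum ::
  "('g, 'm) monoid_scheme \<Rightarrow> 'x topology \<Rightarrow> ('g \<Rightarrow> 'x \<Rightarrow> 'x) \<Rightarrow> 'g set set set" where
  "recurrence_spectrum G X \<phi> =
     {\<F>. upward_closed_family G \<F> \<and>
       (\<forall>F. superequivalence G (topspace X) \<phi> F \<and>
            F \<in> sets (borel_of (prod_topology X X)) \<and> smooth_rel X F \<longrightarrow>
         (\<exists>C \<in> topspace X // F.
            recurrent_on G \<phi> \<F>
              {B \<in> sets (borel_of (subtopology X C)). sigma_complete G \<phi> C B}))}"

definition difference_sets :: "('g, 'm) monoid_scheme \<Rightarrow> 'g set set" where
  "difference_sets G =
     {(\<Union>n. set_inv\<^bsub>G\<^esub> (S n) <#>\<^bsub>G\<^esub> S n) - {\<one>\<^bsub>G\<^esub>} | S :: nat \<Rightarrow> 'g set.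
        \<forall>n. S n \<subseteq> carrier G \<and> finite (S n) \<and> card (S n) = n}"

end

theory Submission
  imports Defs
begin

text \<open>
  The condition that \<open>\<Delta>(Y)\<close> misses \<open>S\<^sup>-\<^sup>1 S - {1}\<close> says exactly that \<open>Y\<close> is \<open>S\<close>-wandering. So a set
  witnessing the third condition also witnesses the first, for the equivalence relation with a
  single class; and the first condition implies the second because Borel sets are universally Baire.

  The remaining implication rests on the closures \<open>K\<close> of single orbits. The orbit is dense in \<open>K\<close>. If
  all classes of \<open>F\<close> were meager in \<open>K\<close>, then \<open>F\<close> would be meager in \<open>K \<times> K\<close> by the Kuratowski--Ulam
  theorem (\<open>meager_in_prod_if_sections_meager\<close>). A meager equivalence relation that contains the orbit
  relation of an action with a dense orbit admits a continuous reduction from eventual equality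
  (\<open>E0_reduces_to_meager\<close>), contradicting smoothness. Hence some class is nonmeager in \<open>K\<close>. Countably
  many translates of the wandering set of this class cover it, so the wandering set is comeager in a
  nonempty open subset of \<open>K\<close>, and this open subset is itself \<open>S n\<close>-wandering for all \<open>n\<close>
  (\<open>wandering_open_in_orbit_closure\<close>).

  That an open set \<open>V\<close> is wandering along the orbit of \<open>x\<close> means that \<open>x\<close> avoids the saturation of
  the open sets \<open>a V \<inter> b V\<close>, which is a closed condition on \<open>x\<close>. Letting \<open>V\<close> range over a countable
  base therefore yields countably many differences of open sets, each of them \<open>S n\<close>-wandering for all
  \<open>n\<close>, whose saturations cover the space. Making these saturations disjoint turns the union into one
  wandering \<open>F\<^sub>\<sigma>\<close> set (\<open>sigma_complete_fsigma_wandering\<close>). It is \<open>\<sigma>\<close>-complete because a point that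
  can be moved into an open set can be moved there by an element of a countable dense subset of \<open>G\<close>.
\<close>

section \<open>Meager sets and the Baire property\<close>

text \<open>
  The closures of nowhere dense sets are again nowhere dense. Covering by closed sets, rather than
  splitting into nowhere dense ones, makes subsets, unions and homeomorphic images immediate.
\<close>

lemma meager_in_iff_subset_closed:
  "meager_in X A \<longleftrightarrow>
     (\<exists>K :: nat \<Rightarrow> 'a set. (\<forall>n. closedin X (K n) \<and> X interior_of (K n) = {}) \<and> A \<subseteq> (\<Union>n. K n))"
  (is "?L \<longleftrightarrow> ?R")
proof
  assume ?L
  then obtain N :: "nat \<Rightarrow> 'a set" where N: "\<And>n. nowhere_dense_in X (N n)" "A = (\<Union>n. N n)"
    unfolding meager_in_def by blast
  have "\<forall>n. closedin X (X closure_of N n) \<and> X interior_of (X closure_of N n) = {}"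
    using N(1) unfolding nowhere_dense_in_def by simp
  moreover have "N n \<subseteq> X closure_of N n" for n
    using N(1)[of n] by (intro closure_of_subset) (simp add: nowhere_dense_in_def)
  then have "A \<subseteq> (\<Union>n. X closure_of N n)"
    unfolding N(2) by (intro UN_mono) auto
  ultimately show ?R by (intro exI[of _ "\<lambda>n. X closure_of N n"]) simp
next
  assume ?R
  then obtain K :: "nat \<Rightarrow> 'a set"
    where K: "\<And>n. closedin X (K n)" "\<And>n. X interior_of (K n) = {}" "A \<subseteq> (\<Union>n. K n)"
    by blast
  have "nowhere_dense_in X (A \<inter> K n)" for n
  proof -
    have "X closure_of (A \<inter> K n) \<subseteq> K n"
      by (simp add: K(1) closure_of_minimal)
    then have "X interior_of (X closure_of (A \<inter> K n)) = {}"
      using K(2) interior_of_mono by blast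
    then show ?thesis
      unfolding nowhere_dense_in_def using closedin_subset[OF K(1)] by blast
  qed
  moreover have "A = (\<Union>n. A \<inter> K n)"
    using K(3) by blast
  ultimately show ?L
    unfolding meager_in_def by (intro exI[of _ "\<lambda>n. A \<inter> K n"]) auto
qed

lemma meager_in_mono: "meager_in X B \<Longrightarrow> A \<subseteq> B \<Longrightarrow> meager_in X A"
  unfolding meager_in_iff_subset_closed by blast

lemma meager_in_nowhere_dense_closed:
  "closedin X K \<Longrightarrow> X interior_of K = {} \<Longrightarrow> meager_in X K"
  unfolding meager_in_iff_subset_closed by (intro exI[of _ "\<lambda>_. K"]) auto

lemma meager_in_empty: "meager_in X {}"
  by (rule meager_in_nowhere_dense_closed) auto

lemma meager_in_UN_nat:
  fixes A :: "nat \<Rightarrow> 'a set"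
  assumes "\<And>n. meager_in X (A n)"
  shows "meager_in X (\<Union>n. A n)"
proof -
  have "\<forall>n. \<exists>K :: nat \<Rightarrow> 'a set.
      (\<forall>m. closedin X (K m) \<and> X interior_of (K m) = {}) \<and> A n \<subseteq> (\<Union>m. K m)"
    using assms unfolding meager_in_iff_subset_closed by blast
  then obtain K :: "nat \<Rightarrow> nat \<Rightarrow> 'a set"
    where K: "\<And>n m. closedin X (K n m) \<and> X interior_of (K n m) = {}" "\<And>n. A n \<subseteq> (\<Union>m. K n m)"
    by metis
  define L where "L i = (case prod_decode i of (n, m) \<Rightarrow> K n m)" for i
  have "A n \<subseteq> (\<Union>i. L i)" for n
  proof
    fix x assume "x \<in> A n"
    then obtain m where "x \<in> K n m" using K(2) by blast
    then have "x \<in> L (prod_encode (n, m))" unfolding L_def by simp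
    then show "x \<in> (\<Union>i. L i)" by blast
  qed
  then have "(\<Union>n. A n) \<subseteq> (\<Union>i. L i)" by blast
  moreover have "\<forall>i. closedin X (L i) \<and> X interior_of (L i) = {}"
    unfolding L_def using K(1) by (simp split: prod.split)
  ultimately show ?thesis
    unfolding meager_in_iff_subset_closed by blast
qed

lemma meager_in_UN:
  assumes "countable I" "\<And>i. i \<in> I \<Longrightarrow> meager_in X (A i)"
  shows "meager_in X (\<Union>i\<in>I. A i)"
proof (cases "I = {}")
  case False
  have "(\<Union>i\<in>I. A i) = (\<Union>n. A (from_nat_into I n))"
    using range_from_nat_into[OF False assms(1)] by (metis image_image)
  then show ?thesis
    using meager_in_UN_nat[of X "\<lambda>n. A (from_nat_into I n)"] from_nat_into[OF False] assms(2) by simp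
qed (simp add: meager_in_empty)

lemma meager_in_Un: "meager_in X A \<Longrightarrow> meager_in X B \<Longrightarrow> meager_in X (A \<union> B)"
  using meager_in_UN[of "{A, B}" X "\<lambda>S. S"] by auto

text \<open>
  This is the Baire category theorem in the form in which it is applied throughout: to refute that a
  nonempty open set is meager.
\<close>

lemma open_meager_in_empty:
  assumes "completely_metrizable_space X" "openin X U" "meager_in X U"
  shows "U = {}"
proof -
  obtain K :: "nat \<Rightarrow> 'a set"
    where K: "\<And>n. closedin X (K n) \<and> X interior_of (K n) = {}" "U \<subseteq> (\<Union>n. K n)"
    using assms(3) unfolding meager_in_iff_subset_closed by blast
  have "X interior_of (\<Union>(range K)) = {}"
    by (rule Baire_category_alt) (use assms(1) K(1) in auto)
  then show ?thesis
    using interior_of_maximal[OF _ assms(2)] K(2) by blast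
qed

lemma meager_in_homeomorphic_image:
  assumes h: "homeomorphic_map X Y h" and A: "meager_in X A"
  shows "meager_in Y (h ` A)"
proof -
  obtain K :: "nat \<Rightarrow> 'a set"
    where K: "\<And>n. closedin X (K n)" "\<And>n. X interior_of (K n) = {}" "A \<subseteq> (\<Union>n. K n)"
    using A unfolding meager_in_iff_subset_closed by blast
  have "\<forall>n. closedin Y (h ` K n) \<and> Y interior_of (h ` K n) = {}"
    using K h homeomorphic_map_closedness_eq homeomorphic_map_interior_of[OF h]
    by (metis closedin_subset image_empty)
  moreover have "h ` A \<subseteq> (\<Union>n. h ` K n)" using K(3) by blast
  ultimately show ?thesis
    unfolding meager_in_iff_subset_closed by (intro exI[of _ "\<lambda>n. h ` K n"]) blast
qed

lemma Baire_property_in_homeomorphic_image: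
  assumes h: "homeomorphic_map X Y h" and A: "Baire_property_in X A"
  shows "Baire_property_in Y (h ` A)"
proof -
  obtain U where U: "openin X U" "meager_in X ((A - U) \<union> (U - A))" and AX: "A \<subseteq> topspace X"
    using A unfolding Baire_property_in_def by blast
  have inj: "inj_on h (topspace X)" and UX: "U \<subseteq> topspace X"
    using h homeomorphic_imp_injective_map U(1) openin_subset by blast+
  have "(h ` A - h ` U) \<union> (h ` U - h ` A) = h ` ((A - U) \<union> (U - A))"
    using inj_on_image_set_diff[OF inj, of A U] inj_on_image_set_diff[OF inj, of U A] AX UX
    by (auto simp: image_Un)
  then have "meager_in Y ((h ` A - h ` U) \<union> (h ` U - h ` A))"
    using meager_in_homeomorphic_image[OF h U(2)] by simp
  moreover have "openin Y (h ` U)"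
    using h U(1) homeomorphic_map_openness_eq by blast
  moreover have "h ` A \<subseteq> topspace Y"
    using AX homeomorphic_imp_surjective_map[OF h] by blast
  ultimately show ?thesis unfolding Baire_property_in_def by blast
qed

lemma Baire_property_in_Diff:
  assumes "Baire_property_in X A"
  shows "Baire_property_in X (topspace X - A)"
proof -
  obtain U where U: "openin X U" "meager_in X ((A - U) \<union> (U - A))" and AX: "A \<subseteq> topspace X"
    using assms unfolding Baire_property_in_def by blast
  \<comment> \<open>The complement of an open set differs from its interior by the nowhere dense boundary.\<close>
  let ?V = "topspace X - X closure_of U"
  let ?O = "X interior_of (X closure_of U - U)"
  have O: "?O \<subseteq> X closure_of U - U" by (rule interior_of_subset)
  then have "?O \<inter> X closure_of U = {}"
    using openin_Int_closure_of_eq_empty[OF openin_interior_of, of X "X closure_of U - U" U] by blast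
  then have "?O = {}" using O by blast
  then have "meager_in X (X closure_of U - U)"
    using U(1) by (intro meager_in_nowhere_dense_closed) (auto simp: closedin_diff)
  then have "meager_in X (((A - U) \<union> (U - A)) \<union> (X closure_of U - U))"
    using U(2) by (rule meager_in_Un[rotated])
  then have "meager_in X (((topspace X - A) - ?V) \<union> (?V - (topspace X - A)))"
    by (rule meager_in_mono) (use closure_of_subset[OF openin_subset[OF U(1)]] in blast)
  moreover have "openin X ?V" by (simp add: openin_diff)
  ultimately show ?thesis unfolding Baire_property_in_def by blast
qed

lemma Baire_property_in_UN:
  fixes A :: "nat \<Rightarrow> 'a set"
  assumes "\<And>n. Baire_property_in X (A n)"
  shows "Baire_property_in X (\<Union>n. A n)"
proof -
  obtain U where U: "\<And>n. openin X (U n)" "\<And>n. meager_in X ((A n - U n) \<union> (U n - A n))"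
    using assms unfolding Baire_property_in_def by metis
  have "meager_in X (\<Union>n. (A n - U n) \<union> (U n - A n))"
    by (rule meager_in_UN_nat) (rule U(2))
  then have "meager_in X (((\<Union>n. A n) - (\<Union>n. U n)) \<union> ((\<Union>n. U n) - (\<Union>n. A n)))"
    by (rule meager_in_mono) blast
  moreover have "openin X (\<Union>n. U n)" using U(1) by blast
  ultimately show ?thesis
    using assms unfolding Baire_property_in_def by blast
qed

lemma space_borel_of [simp]: "space (borel_of X) = topspace X"
  unfolding borel_of_def by (rule space_measure_of) (auto dest: openin_subset)

lemma sets_borel_of: "sets (borel_of X) = sigma_sets (topspace X) {U. openin X U}"
  unfolding borel_of_def by (rule sets_measure_of) (auto dest: openin_subset)

lemma openin_in_sets_borel_of: "openin X U \<Longrightarrow> U \<in> sets (borel_of X)"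
  unfolding sets_borel_of by (rule sigma_sets.Basic) simp

lemma closedin_in_sets_borel_of:
  assumes "closedin X K"
  shows "K \<in> sets (borel_of X)"
proof -
  have "topspace X - (topspace X - K) \<in> sets (borel_of X)"
    using sets.compl_sets[OF openin_in_sets_borel_of[of X "topspace X - K"]] assms
    by (simp add: openin_diff)
  then show ?thesis using closedin_subset[OF assms] by (simp add: double_diff)
qed

lemma fsigma_in_in_sets_borel_of:
  assumes "fsigma_in X A"
  shows "A \<in> sets (borel_of X)"
proof -
  obtain C :: "nat \<Rightarrow> 'a set" where "\<And>n. closedin X (C n)" "(\<Union>n. C n) = A"
    using assms unfolding fsigma_in_ascending by blast
  then show ?thesis using closedin_in_sets_borel_of[of X] by auto
qed

lemma Baire_property_in_open: "openin X U \<Longrightarrow> Baire_property_in X U"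
  unfolding Baire_property_in_def by (auto dest: openin_subset intro!: exI[of _ U] meager_in_empty)

text \<open>
  The sets with the Baire property form a \<open>\<sigma>\<close>-algebra containing the open sets.
\<close>

lemma Baire_property_in_borel:
  assumes "A \<in> sets (borel_of X)"
  shows "Baire_property_in X A"
  using assms unfolding sets_borel_of
proof (induction rule: sigma_sets.induct)
  case (Basic U)
  then show ?case by (simp add: Baire_property_in_open)
next
  case Empty
  then show ?case by (simp add: Baire_property_in_open)
next
  case (Compl A)
  then show ?case by (simp add: Baire_property_in_Diff)
next
  case (Union A)
  show ?case by (rule Baire_property_in_UN) (rule Union.IH)
qed

lemma Baire_property_in_Int:
  assumes "Baire_property_in X A" "Baire_property_in X B"
  shows "Baire_property_in X (A \<inter> B)"
proof -
  define S where "S n = (if n = (0::nat) then topspace X - A else topspace X - B)" for n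
  have "Baire_property_in X (topspace X - (\<Union>n. S n))"
    unfolding S_def using assms Baire_property_in_Diff
    by (intro Baire_property_in_Diff[of X "\<Union>n. S n" for S] Baire_property_in_UN) auto
  moreover have "topspace X - (\<Union>n. S n) = A \<inter> B"
    using assms unfolding S_def Baire_property_in_def by (auto split: if_splits)
  ultimately show ?thesis by simp
qed

text \<open>
  A nonmeager set with the Baire property is comeager in some nonempty open set, so it can be
  replaced by an open set when only category matters.
\<close>

lemma nonmeager_Baire_property_in:
  assumes "Baire_property_in X A" "\<not> meager_in X A"
  obtains U where "openin X U" "U \<noteq> {}" "meager_in X (U - A)"
proof -
  obtain U where U: "openin X U" "meager_in X ((A - U) \<union> (U - A))"
    using assms(1) unfolding Baire_property_in_def by blast
  have "U \<noteq> {}" using U(2) assms(2) by auto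
  moreover have "meager_in X (U - A)" using U(2) by (rule meager_in_mono) blast
  ultimately show thesis using U(1) that by blast
qed

section \<open>Universally Baire sets\<close>

lemma continuous_map_measurable_borel_of:
  assumes "continuous_map X Y f"
  shows "f \<in> measurable (borel_of X) (borel_of Y)"
  unfolding borel_of_def[of Y]
proof (rule measurable_measure_of)
  fix U assume "U \<in> {U. openin Y U}"
  then have "openin X {x \<in> topspace X. f x \<in> U}"
    using assms openin_continuous_map_preimage by blast
  moreover have "f -` U \<inter> space (borel_of X) = {x \<in> topspace X. f x \<in> U}" by auto
  ultimately show "f -` U \<inter> space (borel_of X) \<in> sets (borel_of X)"
    using openin_in_sets_borel_of by simp
qed (use assms continuous_map_funspace in \<open>auto dest: openin_subset\<close>)

text \<open>
  The definition tests only Polish topologies on sets of reals. Transporting the Baire property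
  along a homeomorphism removes this restriction.
\<close>

lemma aleph0_universally_BaireD:
  fixes W :: "'b topology"
  assumes A: "aleph0_universally_Baire Z A" and W: "polish_topology W"
    and f: "f \<in> measurable (borel_of W) (borel_of Z)"
  shows "Baire_property_in W (f -` A \<inter> topspace W)"
proof -
  obtain W' :: "real topology" where W': "polish_topology W'" "W homeomorphic_space W'"
    using polish_topology_homeomorphic_real[OF W] by blast
  then obtain h k where hk: "homeomorphic_maps W W' h k"
    unfolding homeomorphic_space_def by blast
  then have k: "homeomorphic_map W' W k" "continuous_map W' W k"
    unfolding homeomorphic_maps_map by (simp_all add: homeomorphic_imp_continuous_map)
  have "f \<circ> k \<in> measurable (borel_of W') (borel_of Z)"
    using continuous_map_measurable_borel_of[OF k(2)] f by (rule measurable_comp)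
  then have "Baire_property_in W' ((f \<circ> k) -` A \<inter> topspace W')"
    using A W'(1) unfolding aleph0_universally_Baire_def by blast
  then have "Baire_property_in W (k ` ((f \<circ> k) -` A \<inter> topspace W'))"
    by (rule Baire_property_in_homeomorphic_image[OF k(1)])
  moreover have "k ` ((f \<circ> k) -` A \<inter> topspace W') = f -` A \<inter> topspace W"
    using homeomorphic_imp_surjective_map[OF k(1)] by (auto 0 4 simp: image_iff)
  ultimately show ?thesis by simp
qed

lemma aleph0_universally_Baire_borel:
  assumes "A \<in> sets (borel_of Z)"
  shows "aleph0_universally_Baire Z A"
  unfolding aleph0_universally_Baire_def
proof (intro conjI allI impI ballI)
  show "A \<subseteq> topspace Z" using sets.sets_into_space[OF assms] by simp
  fix W :: "real topology" and f
  assume "f \<in> measurable (borel_of W) (borel_of Z)"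
  then have "f -` A \<inter> space (borel_of W) \<in> sets (borel_of W)"
    using assms by (rule measurable_sets)
  then show "Baire_property_in W (f -` A \<inter> topspace W)"
    using Baire_property_in_borel by simp
qed

section \<open>Polish topologies\<close>

lemma second_countable_separable_metrizable:
  assumes "metrizable_space X" "separable_space X"
  shows "second_countable X"
proof -
  obtain M d where Md: "Metric_space M d" "X = Metric_space.mtopology M d"
    using assms(1) unfolding metrizable_space_def by blast
  interpret Metric_space M d by (rule Md(1))
  obtain C where C: "countable C" "C \<subseteq> M" "mtopology closure_of C = M"
    using assms(2) Md(2) unfolding separable_space_def by auto
  define \<B> where "\<B> = (\<lambda>(c, n). mball c (inverse (Suc n))) ` (C \<times> (UNIV :: nat set))"
  have "\<exists>V \<in> \<B>. x \<in> V \<and> V \<subseteq> U" if U: "openin mtopology U" "x \<in> U" for U x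
  proof -
    obtain r where r: "r > 0" "mball x r \<subseteq> U"
      using U unfolding openin_mtopology by blast
    have xM: "x \<in> M" using U openin_subset by fastforce
    obtain n where n: "inverse (real (Suc n)) < r / 2"
      using reals_Archimedean[of "r / 2"] r(1) by auto
    have "x \<in> mtopology closure_of C" using C(3) xM by simp
    then obtain c where c: "c \<in> C" "c \<in> mball x (inverse (Suc n))"
      unfolding metric_closure_of by (smt (verit, best) inverse_positive_iff_positive mem_Collect_eq of_nat_0_less_iff zero_less_Suc)
    have "mball c (inverse (Suc n)) \<subseteq> mball x r"
    proof
      fix y assume y: "y \<in> mball c (inverse (Suc n))"
      have "d x y \<le> d x c + d c y" using triangle xM y c by auto
      then show "y \<in> mball x r" using y c n xM by auto
    qed
    then show ?thesis
      using c r(2) commute unfolding \<B>_def by (intro bexI[of _ "mball c (inverse (Suc n))"]) auto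
  qed
  moreover have "countable \<B>" "\<forall>V \<in> \<B>. openin mtopology V"
    unfolding \<B>_def using C(1) by auto
  ultimately show ?thesis unfolding second_countable_def Md(2) by blast
qed

lemma polish_topology_second_countable: "polish_topology X \<Longrightarrow> second_countable X"
  by (simp add: polish_topology_def completely_metrizable_imp_metrizable_space
      second_countable_separable_metrizable)

lemma polish_topology_closed_subspace:
  assumes "polish_topology X" "closedin X S"
  shows "polish_topology (subtopology X S)"
  using assms polish_topology_second_countable second_countable_subtopology
    second_countable_imp_separable_space completely_metrizable_space_closedin
  unfolding polish_topology_def by blast

lemma polish_topology_prod:
  assumes "polish_topology X" "polish_topology Y"
  shows "polish_topology (prod_topology X Y)"
proof -
  obtain C D where "countable C" "C \<subseteq> topspace X" "X closure_of C = topspace X"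
    "countable D" "D \<subseteq> topspace Y" "Y closure_of D = topspace Y"
    using assms unfolding polish_topology_def separable_space_def by blast
  then have "separable_space (prod_topology X Y)"
    unfolding separable_space_def
    by (intro exI[of _ "C \<times> D"]) (auto simp: closure_of_Times)
  then show ?thesis
    using assms unfolding polish_topology_def completely_metrizable_space_prod_topology by blast
qed

section \<open>Meager sets in products\<close>

text \<open>
  This is one half of the Kuratowski--Ulam theorem. For a closed set \<open>K\<close> with empty interior and a
  basic open set \<open>V \<noteq> {}\<close>, the points \<open>x\<close> with \<open>{x} \<times> V \<subseteq> K\<close> form a closed set with empty interior,
  and a section of \<open>K\<close> with nonempty interior contains some such \<open>V\<close>. Since there are only countably
  many \<open>V\<close>, almost all sections of \<open>K\<close> are nowhere dense.
\<close>

lemma meager_in_prod_sections: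
  fixes X :: "'a topology" and Y :: "'b topology"
  assumes Y: "second_countable Y" and A: "meager_in (prod_topology X Y) A"
  shows "meager_in X {x \<in> topspace X. \<not> meager_in Y (A `` {x})}"
proof -
  obtain K :: "nat \<Rightarrow> ('a \<times> 'b) set"
    where K: "\<And>n. closedin (prod_topology X Y) (K n)"
      "\<And>n. prod_topology X Y interior_of (K n) = {}" "A \<subseteq> (\<Union>n. K n)"
    using A unfolding meager_in_iff_subset_closed by blast
  obtain \<B> where \<B>: "countable \<B>" "\<And>V. V \<in> \<B> \<Longrightarrow> openin Y V"
    "\<And>U y. openin Y U \<Longrightarrow> y \<in> U \<Longrightarrow> \<exists>V \<in> \<B>. y \<in> V \<and> V \<subseteq> U"
    using Y unfolding second_countable_def by metis
  define E where "E n V = {x \<in> topspace X. {x} \<times> V \<subseteq> K n}" for n V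
  have E: "meager_in X (E n V)" if V: "V \<in> \<B> - {{}}" for n V
  proof (rule meager_in_nowhere_dense_closed)
    have "openin (prod_topology X Y) ((topspace X \<times> V) - K n)"
      using K(1) \<B>(2) V by (auto intro!: openin_diff simp: openin_prod_Times_iff)
    then have "openin X (fst ` ((topspace X \<times> V) - K n))"
      using open_map_fst unfolding open_map_def by blast
    moreover have "E n V = topspace X - fst ` ((topspace X \<times> V) - K n)"
      unfolding E_def by force
    ultimately show "closedin X (E n V)" by (simp add: closedin_diff)
    have "(X interior_of E n V) \<times> V \<subseteq> prod_topology X Y interior_of (K n)"
    proof (rule interior_of_maximal)
      show "(X interior_of E n V) \<times> V \<subseteq> K n"
        using interior_of_subset[of X "E n V"] unfolding E_def by blast
      show "openin (prod_topology X Y) ((X interior_of E n V) \<times> V)"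
        using \<B>(2) V by (simp add: openin_prod_Times_iff)
    qed
    then show "X interior_of E n V = {}" using K(2) V by auto
  qed
  have "meager_in X (\<Union>n. \<Union>V \<in> \<B> - {{}}. E n V)"
    using \<B>(1) E by (intro meager_in_UN_nat meager_in_UN) auto
  then show ?thesis
  proof (rule meager_in_mono, intro subsetI)
    fix x assume "x \<in> {x \<in> topspace X. \<not> meager_in Y (A `` {x})}"
    then have x: "x \<in> topspace X" "\<not> meager_in Y (A `` {x})" by auto
    have "\<exists>n. Y interior_of (K n `` {x}) \<noteq> {}"
    proof (rule ccontr)
      assume "\<not> ?thesis"
      moreover have "closedin Y (K n `` {x})" for n
      proof -
        have "continuous_map Y (prod_topology X Y) (\<lambda>y. (x, y))"
          using x(1) by (simp add: continuous_map_pairwise o_def)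
        then have "closedin Y {y \<in> topspace Y. (x, y) \<in> K n}"
          using K(1) closedin_continuous_map_preimage by blast
        moreover have "{y \<in> topspace Y. (x, y) \<in> K n} = K n `` {x}"
          using closedin_subset[OF K(1)] by fastforce
        ultimately show ?thesis by simp
      qed
      moreover have "A `` {x} \<subseteq> (\<Union>n. K n `` {x})" using K(3) by blast
      ultimately have "meager_in Y (A `` {x})"
        unfolding meager_in_iff_subset_closed by (intro exI[of _ "\<lambda>n. K n `` {x}"]) simp
      then show False using x(2) by contradiction
    qed
    then obtain n y where "y \<in> Y interior_of (K n `` {x})" by (metis ex_in_conv)
    then obtain V where "V \<in> \<B>" "y \<in> V" "V \<subseteq> Y interior_of (K n `` {x})"
      using \<B>(3)[OF openin_interior_of] by blast
    then have "V \<in> \<B> - {{}}" "x \<in> E n V"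
      using x(1) interior_of_subset[of Y "K n `` {x}"] unfolding E_def by auto
    then show "x \<in> (\<Union>n. \<Union>V \<in> \<B> - {{}}. E n V)" by blast
  qed
qed

text \<open>
  A nonmeager set with the Baire property is comeager in a box \<open>U \<times> V\<close>, so one of its sections over
  \<open>U\<close> would be comeager in \<open>V\<close>.
\<close>

lemma meager_in_prod_if_sections_meager:
  fixes X :: "'a topology" and Y :: "'b topology"
  assumes X: "completely_metrizable_space X" and Y: "completely_metrizable_space Y"
    "second_countable Y"
    and F: "Baire_property_in (prod_topology X Y) F"
    and sec: "\<And>x. x \<in> topspace X \<Longrightarrow> meager_in Y (F `` {x})"
  shows "meager_in (prod_topology X Y) F"
proof (rule ccontr)
  assume "\<not> ?thesis"
  then obtain O' where O': "openin (prod_topology X Y) O'" "O' \<noteq> {}"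
    "meager_in (prod_topology X Y) (O' - F)"
    using nonmeager_Baire_property_in[OF F] by metis
  then obtain x0 y0 where "(x0, y0) \<in> O'" by auto
  then obtain U V where UV: "openin X U" "openin Y V" "x0 \<in> U" "y0 \<in> V" "U \<times> V \<subseteq> O'"
    using O'(1) unfolding openin_prod_topology_alt by metis
  have "meager_in X {x \<in> topspace X. \<not> meager_in Y ((O' - F) `` {x})}"
    by (rule meager_in_prod_sections[OF Y(2) O'(3)])
  moreover have "\<not> meager_in X U"
    using open_meager_in_empty[OF X UV(1)] UV(3) by blast
  ultimately obtain x where x: "x \<in> U" "meager_in Y ((O' - F) `` {x})"
    using meager_in_mono openin_subset[OF UV(1)] by blast
  have "meager_in Y (F `` {x} \<union> (O' - F) `` {x})"
    using sec x openin_subset[OF UV(1)] by (intro meager_in_Un) auto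
  then have "meager_in Y V"
    by (rule meager_in_mono) (use x(1) UV(5) in blast)
  then show False
    using open_meager_in_empty[OF Y(1) UV(2)] UV(4) by blast
qed

section \<open>Groups acting by homeomorphisms\<close>

text \<open>
  The topology is a parameter because the action is used on the whole space, on closures of orbits
  and on classes of an invariant equivalence relation. The elements of \<open>group_action\<close> are maps that
  are extensional on the set acted on, so restricting such an action changes the maps themselves;
  here the same \<open>\<phi>\<close> serves for all invariant subspaces.
\<close>

locale acts_by_homeomorphisms = group G for G (structure) +
  fixes Z :: "'x topology" and \<phi> :: "'a \<Rightarrow> 'x \<Rightarrow> 'x"
  assumes continuous: "g \<in> carrier G \<Longrightarrow> continuous_map Z Z (\<phi> g)"
    and act_one: "x \<in> topspace Z \<Longrightarrow> \<phi> \<one> x = x"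
    and act_mult: "g \<in> carrier G \<Longrightarrow> h \<in> carrier G \<Longrightarrow> x \<in> topspace Z \<Longrightarrow>
      \<phi> (g \<otimes> h) x = \<phi> g (\<phi> h x)"
begin

lemma act_closed: "g \<in> carrier G \<Longrightarrow> x \<in> topspace Z \<Longrightarrow> \<phi> g x \<in> topspace Z"
  using continuous continuous_map_image_subset_topspace by blast

lemma act_inv:
  assumes "g \<in> carrier G" "x \<in> topspace Z"
  shows "\<phi> (inv g) (\<phi> g x) = x" "\<phi> g (\<phi> (inv g) x) = x"
  using assms act_mult[of "inv g" g x] act_mult[of g "inv g" x] act_one by auto

lemma homeomorphic_maps_act:
  "g \<in> carrier G \<Longrightarrow> homeomorphic_maps Z Z (\<phi> g) (\<phi> (inv g))"
  unfolding homeomorphic_maps_def by (simp add: continuous act_inv)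

lemma homeomorphic_map_act: "g \<in> carrier G \<Longrightarrow> homeomorphic_map Z Z (\<phi> g)"
  using homeomorphic_maps_act homeomorphic_maps_map by blast

lemma openin_act_image: "g \<in> carrier G \<Longrightarrow> openin Z U \<Longrightarrow> openin Z (\<phi> g ` U)"
  using homeomorphic_map_act homeomorphic_map_openness_eq by blast

lemma closedin_act_image: "g \<in> carrier G \<Longrightarrow> closedin Z U \<Longrightarrow> closedin Z (\<phi> g ` U)"
  using homeomorphic_map_act homeomorphic_map_closedness_eq by blast

lemma act_restrict_invariant:
  assumes "S \<subseteq> topspace Z" "\<And>g x. g \<in> carrier G \<Longrightarrow> x \<in> S \<Longrightarrow> \<phi> g x \<in> S"
  shows "acts_by_homeomorphisms G (subtopology Z S) \<phi>"
proof
  fix g assume g: "g \<in> carrier G"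
  show "continuous_map (subtopology Z S) (subtopology Z S) (\<phi> g)"
    using assms g continuous[OF g]
    by (auto simp: continuous_map_in_subtopology intro: continuous_map_from_subtopology)
qed (use assms act_one act_mult in auto)

lemma orbit_closure_invariant:
  assumes g: "g \<in> carrier G" and x: "x \<in> topspace Z" and y: "y \<in> Z closure_of (orbit G \<phi> x)"
  shows "\<phi> g y \<in> Z closure_of (orbit G \<phi> x)"
proof -
  have "\<phi> g ` (Z closure_of (orbit G \<phi> x)) \<subseteq> Z closure_of (\<phi> g ` orbit G \<phi> x)"
    using continuous[OF g] by (rule continuous_map_image_closure_subset)
  moreover have "\<phi> g ` orbit G \<phi> x \<subseteq> orbit G \<phi> x"
    unfolding orbit_def using g x by (force simp flip: act_mult)
  ultimately show ?thesis
    using y closure_of_mono[of "\<phi> g ` orbit G \<phi> x" "orbit G \<phi> x" Z] by blast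
qed

end

section \<open>Reducing the eventual equality relation\<close>

context acts_by_homeomorphisms
begin

text \<open>
  The construction below builds a Cantor scheme whose sets at level \<open>n\<close> are the translates of a
  single open set \<open>U\<close> by a finite set \<open>P\<close> of group elements; this lemma gives the passage to level
  \<open>n + 1\<close>. The new set \<open>V\<close> and its translate by \<open>g\<close> both lie in \<open>U\<close>, and they are pushed off the
  meager closed set \<open>L\<close> simultaneously for all pairs of elements of \<open>P\<close>. Such a \<open>g\<close> exists because
  the preimages of \<open>L\<close> under finitely many homeomorphisms cannot cover \<open>U \<times> U\<close>, and because a dense
  orbit has pairs of points in every box.
\<close>

lemma splitting_step:
  fixes d :: "'x \<Rightarrow> 'x \<Rightarrow> real"
  assumes M: "Metric_space M d" "Z = Metric_space.mtopology M d" and cm: "completely_metrizable_space Z"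
    and z0: "z0 \<in> topspace Z" "Z closure_of (orbit G \<phi> z0) = topspace Z"
    and U: "openin Z U" "U \<noteq> {}" and P: "finite P" "P \<subseteq> carrier G"
    and L: "closedin (prod_topology Z Z) L" "meager_in (prod_topology Z Z) L" and \<epsilon>: "\<epsilon> > 0"
  shows "\<exists>g\<in>carrier G. \<exists>V. openin Z V \<and> V \<noteq> {} \<and> Z closure_of V \<subseteq> U \<and> \<phi> g ` (Z closure_of V) \<subseteq> U \<and>
    (\<forall>a\<in>P. \<forall>b\<in>P. \<forall>u\<in>V. \<forall>v\<in>V. (\<phi> a u, \<phi> (b \<otimes> g) v) \<notin> L) \<and>
    (\<forall>a \<in> P \<union> (\<lambda>b. b \<otimes> g) ` P. \<forall>u\<in>V. \<forall>v\<in>V. d (\<phi> a u) (\<phi> a v) < \<epsilon>)"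
proof -
  interpret Metric_space M d by (rule M(1))
  have tZ: "topspace Z = M" by (simp add: M(2))
  let ?ZZ = "prod_topology Z Z"
  define N where "N a b = {w \<in> topspace ?ZZ. (case w of (x, y) \<Rightarrow> (\<phi> a x, \<phi> b y)) \<in> L}" for a b
  have N: "closedin ?ZZ (N a b)" "meager_in ?ZZ (N a b)" if ab: "a \<in> P" "b \<in> P" for a b
  proof -
    have g: "a \<in> carrier G" "b \<in> carrier G" using ab P(2) by auto
    have hm: "homeomorphic_maps ?ZZ ?ZZ (\<lambda>(x, y). (\<phi> a x, \<phi> b y)) (\<lambda>(x, y). (\<phi> (inv a) x, \<phi> (inv b) y))"
      unfolding homeomorphic_maps_prod using g homeomorphic_maps_act by blast
    then have "continuous_map ?ZZ ?ZZ (\<lambda>(x, y). (\<phi> a x, \<phi> b y))"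
      unfolding homeomorphic_maps_def by blast
    then show "closedin ?ZZ (N a b)"
      unfolding N_def using L(1) by (rule closedin_continuous_map_preimage)
    have "homeomorphic_map ?ZZ ?ZZ (\<lambda>(x, y). (\<phi> (inv a) x, \<phi> (inv b) y))"
      using hm unfolding homeomorphic_maps_map by blast
    then have "meager_in ?ZZ ((\<lambda>(x, y). (\<phi> (inv a) x, \<phi> (inv b) y)) ` L)"
      using L(2) by (rule meager_in_homeomorphic_image)
    moreover have "N a b \<subseteq> (\<lambda>(x, y). (\<phi> (inv a) x, \<phi> (inv b) y)) ` L"
    proof
      fix w assume "w \<in> N a b"
      then obtain x y where w: "w = (x, y)" "x \<in> topspace Z" "y \<in> topspace Z" "(\<phi> a x, \<phi> b y) \<in> L"
        unfolding N_def by auto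
      then have "w = (\<lambda>(x, y). (\<phi> (inv a) x, \<phi> (inv b) y)) (\<phi> a x, \<phi> b y)"
        using act_inv(1) g by simp
      then show "w \<in> (\<lambda>(x, y). (\<phi> (inv a) x, \<phi> (inv b) y)) ` L" using w(4) by (rule image_eqI)
    qed
    ultimately show "meager_in ?ZZ (N a b)" by (rule meager_in_mono)
  qed
  define W where "W = (\<Union>(a, b) \<in> P \<times> P. N a b)"
  have W: "closedin ?ZZ W" "meager_in ?ZZ W"
    unfolding W_def using N P(1)
    by (auto intro!: closedin_Union meager_in_UN simp: countable_finite)
  have UU: "openin ?ZZ (U \<times> U)" using U(1) by (simp add: openin_prod_Times_iff)
  have cmZZ: "completely_metrizable_space ?ZZ"
    using cm by (simp add: completely_metrizable_space_prod_topology)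
  have "\<not> meager_in ?ZZ (U \<times> U)"
    using open_meager_in_empty[OF cmZZ UU] U(2) by blast
  then have "\<not> U \<times> U \<subseteq> W" using W(2) meager_in_mono by blast
  then obtain x y where xy: "(x, y) \<in> U \<times> U - W" by auto
  have "openin ?ZZ (U \<times> U - W)" using UU W(1) by (rule openin_diff)
  then obtain A B where AB: "openin Z A" "openin Z B" "x \<in> A" "y \<in> B" "A \<times> B \<subseteq> U \<times> U - W"
    using xy unfolding openin_prod_topology_alt by metis
  have AU: "A \<subseteq> U" "B \<subseteq> U" using AB(3-5) by auto
  have "A \<inter> orbit G \<phi> z0 \<noteq> {}" "B \<inter> orbit G \<phi> z0 \<noteq> {}"
    using AB(1-4) z0(2) openin_subset openin_Int_closure_of_eq_empty[of Z _ "orbit G \<phi> z0"]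
    by (metis Int_iff empty_iff subsetD)+
  then obtain g1 g2 where g12: "g1 \<in> carrier G" "g2 \<in> carrier G" "\<phi> g1 z0 \<in> A" "\<phi> g2 z0 \<in> B"
    unfolding orbit_def by blast
  define g where "g = g2 \<otimes> inv g1"
  define w where "w = \<phi> g1 z0"
  have g: "g \<in> carrier G" unfolding g_def using g12 by simp
  have wZ: "w \<in> topspace Z" unfolding w_def using act_closed g12 z0 by blast
  have "\<phi> g w = \<phi> g2 (\<phi> (inv g1) (\<phi> g1 z0))"
    unfolding g_def w_def using act_mult act_closed g12 z0 by simp
  then have gw: "\<phi> g w \<in> B" using act_inv(1) g12 z0 by simp
  define P' where "P' = P \<union> (\<lambda>b. b \<otimes> g) ` P"
  have P': "finite P'" "P' \<subseteq> carrier G" unfolding P'_def using P g by auto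
  define R where "R a = {v \<in> topspace Z. \<phi> a v \<in> mball (\<phi> a w) (\<epsilon> / 2)}" for a
  have R: "openin Z (R a)" "w \<in> R a" if "a \<in> P'" for a
  proof -
    have a: "a \<in> carrier G" using that P'(2) by blast
    show "openin Z (R a)" unfolding R_def
      using continuous[OF a] by (rule openin_continuous_map_preimage) (simp add: M(2))
    show "w \<in> R a" unfolding R_def using \<epsilon> wZ act_closed[OF a wZ] tZ by simp
  qed
  \<comment> \<open>All demands on \<open>V\<close> are open conditions on its points, and \<open>w\<close> satisfies them.\<close>
  define A' where "A' = A \<inter> {v \<in> topspace Z. \<phi> g v \<in> B} \<inter> ((\<Inter>a\<in>P'. R a) \<inter> topspace Z)"
  have "openin Z {v \<in> topspace Z. \<phi> g v \<in> B}"
    using continuous[OF g] AB(2) by (rule openin_continuous_map_preimage)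
  then have oA': "openin Z A'" unfolding A'_def
    using AB(1) R(1) P'(1) by (intro openin_Int openin_INT) auto
  have wA': "w \<in> A'" unfolding A'_def using g12 w_def gw R(2) wZ by auto
  have "regular_space Z"
    using cm completely_metrizable_imp_metrizable_space metrizable_imp_regular_space by blast
  then obtain V where V: "openin Z V" "w \<in> V" "disjnt (topspace Z - A') (Z closure_of V)"
    unfolding regular_space using oA' wA' wZ by (metis Diff_iff closedin_diff closedin_topspace)
  have clV: "Z closure_of V \<subseteq> A'"
    using V(3) closure_of_subset_topspace[of Z V] unfolding disjnt_def by blast
  have VA': "V \<subseteq> A'"
    using clV closure_of_subset[OF openin_subset[OF V(1)]] by blast
  show ?thesis
  proof (intro bexI[OF _ g] exI[of _ V] conjI ballI)
    show "openin Z V" "V \<noteq> {}" using V by auto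
    show "Z closure_of V \<subseteq> U" "\<phi> g ` (Z closure_of V) \<subseteq> U"
      using clV AU unfolding A'_def by auto
  next
    fix a b u v assume ab: "a \<in> P" "b \<in> P" and uv: "u \<in> V" "v \<in> V"
    have u: "u \<in> A" "u \<in> topspace Z" and v: "\<phi> g v \<in> B" "v \<in> topspace Z"
      using uv VA' unfolding A'_def by auto
    then have "(u, \<phi> g v) \<notin> N a b" using AB(5) ab unfolding W_def by blast
    then have "(\<phi> a u, \<phi> b (\<phi> g v)) \<notin> L" unfolding N_def using u v act_closed[OF g] by simp
    then show "(\<phi> a u, \<phi> (b \<otimes> g) v) \<notin> L" using act_mult ab g v P(2) by (simp add: subset_iff)
  next
    fix a u v assume "a \<in> P \<union> (\<lambda>b. b \<otimes> g) ` P" and uv: "u \<in> V" "v \<in> V"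
    then have "a \<in> P'" unfolding P'_def by blast
    then have "u \<in> R a" "v \<in> R a" using uv VA' unfolding A'_def by auto
    then have "\<phi> a w \<in> M" "\<phi> a u \<in> M" "\<phi> a v \<in> M" "d (\<phi> a w) (\<phi> a u) < \<epsilon> / 2" "d (\<phi> a w) (\<phi> a v) < \<epsilon> / 2"
      unfolding R_def by auto
    then show "d (\<phi> a u) (\<phi> a v) < \<epsilon>"
      using triangle[of "\<phi> a u" "\<phi> a w" "\<phi> a v"] commute[of "\<phi> a u" "\<phi> a w"] by linarith
  qed
qed

text \<open>
  A meager equivalence relation containing the orbit relation of an action with a dense orbit is
  not smooth. Write the relation as a subset of an increasing union of closed nowhere dense sets
  \<open>L n\<close>. Choosing \<open>g n\<close> by the preceding lemma, send \<open>c\<close> to the unique point in the intersection of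
  the sets \<open>g 0^(c 0) \<dots> g (n - 1)^(c (n - 1)) U n\<close>. Changing finitely many values of \<open>c\<close> moves this
  point by a group element, while any difference at place \<open>m\<close> keeps the pair of points, taken in a
  suitable order, off \<open>L m\<close>; if there are infinitely many differences, the pair avoids the
  relation.
\<close>

lemma E0_reduces_to_meager:
  assumes cm: "completely_metrizable_space Z"
    and z0: "z0 \<in> topspace Z" "Z closure_of (orbit G \<phi> z0) = topspace Z"
    and F: "sym F" "trans F" "\<And>g x. g \<in> carrier G \<Longrightarrow> x \<in> topspace Z \<Longrightarrow> (x, \<phi> g x) \<in> F"
    and meager: "meager_in (prod_topology Z Z) (F \<inter> (topspace Z \<times> topspace Z))"
  obtains \<pi> where "continuous_map cantor_space Z \<pi>" "\<And>c d. (c, d) \<in> E0 \<longleftrightarrow> (\<pi> c, \<pi> d) \<in> F"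
proof -
  obtain M d where Md: "Metric_space M d" "Metric_space.mcomplete M d" "Z = Metric_space.mtopology M d"
    using cm unfolding completely_metrizable_space_def by blast
  interpret Metric_space M d by (rule Md(1))
  have tZ: "topspace Z = M" by (simp add: Md(3))
  obtain K :: "nat \<Rightarrow> ('x \<times> 'x) set"
    where K: "\<And>n. closedin (prod_topology Z Z) (K n) \<and> prod_topology Z Z interior_of (K n) = {}"
      "F \<inter> (topspace Z \<times> topspace Z) \<subseteq> (\<Union>n. K n)"
    using meager unfolding meager_in_iff_subset_closed by blast
  define L where "L n = (\<Union>i\<le>n. K i)" for n
  have L: "closedin (prod_topology Z Z) (L n)" "meager_in (prod_topology Z Z) (L n)" for n
  proof -
    show "closedin (prod_topology Z Z) (L n)"
      unfolding L_def using K(1) by (intro closedin_Union) auto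
    show "meager_in (prod_topology Z Z) (L n)"
      unfolding L_def using K(1) by (intro meager_in_UN meager_in_nowhere_dense_closed) auto
  qed
  \<comment> \<open>The states of the recursion are pairs of an open set and the finite set of elements that
    translate it.\<close>
  define good :: "nat \<Rightarrow> 'x set \<times> 'a set \<Rightarrow> bool" where
    "good n = (\<lambda>(U, P). openin Z U \<and> U \<noteq> {} \<and> finite P \<and> P \<subseteq> carrier G \<and> (n = 0 \<longrightarrow> P = {\<one>}))" for n
  define succ :: "nat \<Rightarrow> 'x set \<times> 'a set \<Rightarrow> 'x set \<times> 'a set \<Rightarrow> 'a \<Rightarrow> bool" where
    "succ n = (\<lambda>(U, P) (V, Q) g. g \<in> carrier G \<and> Q = P \<union> (\<lambda>b. b \<otimes> g) ` P \<and>
      Z closure_of V \<subseteq> U \<and> \<phi> g ` (Z closure_of V) \<subseteq> U \<and>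
      (\<forall>a\<in>P. \<forall>b\<in>P. \<forall>u\<in>V. \<forall>v\<in>V. (\<phi> a u, \<phi> (b \<otimes> g) v) \<notin> L n) \<and>
      (\<forall>a\<in>Q. \<forall>u\<in>V. \<forall>v\<in>V. d (\<phi> a u) (\<phi> a v) < inverse (real (Suc n))))" for n
  have "\<exists>s. \<forall>n. good n (s n) \<and> (\<exists>g. succ n (s n) (s (Suc n)) g)"
  proof (rule dependent_nat_choice)
    show "\<exists>x. good 0 x"
      by (rule exI[of _ "(topspace Z, {\<one>})"]) (use z0(1) in \<open>auto simp: good_def\<close>)
    fix x n assume x: "good n x"
    obtain U P where UP: "x = (U, P)" by (cases x)
    have U: "openin Z U" "U \<noteq> {}" "finite P" "P \<subseteq> carrier G" using x unfolding UP good_def by auto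
    have "0 < inverse (real (Suc n))" by simp
    from splitting_step[OF Md(1,3) cm z0 U L[of n] this]
    obtain g V where gV: "g \<in> carrier G" "openin Z V" "V \<noteq> {}" "Z closure_of V \<subseteq> U"
      "\<phi> g ` (Z closure_of V) \<subseteq> U"
      "\<forall>a\<in>P. \<forall>b\<in>P. \<forall>u\<in>V. \<forall>v\<in>V. (\<phi> a u, \<phi> (b \<otimes> g) v) \<notin> L n"
      "\<forall>a \<in> P \<union> (\<lambda>b. b \<otimes> g) ` P. \<forall>u\<in>V. \<forall>v\<in>V. d (\<phi> a u) (\<phi> a v) < inverse (real (Suc n))"
      by blast
    have "good (Suc n) (V, P \<union> (\<lambda>b. b \<otimes> g) ` P)"
      unfolding good_def using gV(1-3) U(3,4) by auto
    moreover have "succ n x (V, P \<union> (\<lambda>b. b \<otimes> g) ` P) g"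
      unfolding succ_def UP using gV by simp
    ultimately show "\<exists>y. good (Suc n) y \<and> (\<exists>g. succ n x y g)" by blast
  qed
  then obtain s g where s: "\<And>n. good n (s n)" and sg: "\<And>n. succ n (s n) (s (Suc n)) (g n)"
    by metis
  define U where "U n = fst (s n)" for n
  define P where "P n = snd (s n)" for n
  have s_eq: "s n = (U n, P n)" for n unfolding U_def P_def by simp
  have U: "openin Z (U n)" "U n \<noteq> {}" and P: "P n \<subseteq> carrier G" "P 0 = {\<one>}" for n
    using s[of n] s[of 0] unfolding s_eq good_def by auto
  have g: "g n \<in> carrier G" and PS: "P (Suc n) = P n \<union> (\<lambda>b. b \<otimes> g n) ` P n"
    and cl: "Z closure_of U (Suc n) \<subseteq> U n" "\<phi> (g n) ` (Z closure_of U (Suc n)) \<subseteq> U n"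
    and sep: "\<And>a b u v. a \<in> P n \<Longrightarrow> b \<in> P n \<Longrightarrow> u \<in> U (Suc n) \<Longrightarrow> v \<in> U (Suc n) \<Longrightarrow>
      (\<phi> a u, \<phi> (b \<otimes> g n) v) \<notin> L n"
    and small: "\<And>a u v. a \<in> P (Suc n) \<Longrightarrow> u \<in> U (Suc n) \<Longrightarrow> v \<in> U (Suc n) \<Longrightarrow>
      d (\<phi> a u) (\<phi> a v) < inverse (real (Suc n))" for n
    using sg[of n] unfolding s_eq succ_def by simp_all
  have UZ: "U n \<subseteq> topspace Z" for n by (rule openin_subset[OF U(1)])
  have U_cl: "U n \<subseteq> Z closure_of U n" for n by (rule closure_of_subset[OF UZ])
  define p where "p c = rec_nat \<one> (\<lambda>n h. if c n then h \<otimes> g n else h)" for c :: "nat \<Rightarrow> bool"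
  have p0: "p c 0 = \<one>" and pS: "p c (Suc n) = (if c n then p c n \<otimes> g n else p c n)" for c n
    unfolding p_def by simp_all
  have pP: "p c n \<in> P n" for c n
    by (induction n) (auto simp: p0 pS P(2) PS)
  then have pG: "p c n \<in> carrier G" for c n using P(1) by blast
  define D where "D c n = \<phi> (p c n) ` U n" for c n
  define D' where "D' c n = \<phi> (p c n) ` (Z closure_of U n)" for c n
  have DD': "D c n \<subseteq> D' c n" for c n unfolding D_def D'_def using U_cl by blast
  have D'D: "D' c (Suc n) \<subseteq> D c n" for c n
  proof
    fix z assume "z \<in> D' c (Suc n)"
    then obtain u where u: "u \<in> Z closure_of U (Suc n)" "z = \<phi> (p c (Suc n)) u"
      unfolding D'_def by blast
    have uZ: "u \<in> topspace Z" using u(1) closure_of_subset_topspace by fastforce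
    show "z \<in> D c n"
    proof (cases "c n")
      case True
      then have "z = \<phi> (p c n) (\<phi> (g n) u)" using u(2) act_mult[OF pG g uZ] by (simp add: pS)
      then show ?thesis unfolding D_def using u(1) cl(2)[of n] by blast
    next
      case False
      then show ?thesis unfolding D_def using u cl(1)[of n] by (auto simp: pS)
    qed
  qed
  have DZ: "D c n \<subseteq> M" for c n 
    unfolding D_def tZ[symmetric] by (intro image_subsetI act_closed[OF pG] subsetD[OF UZ])
  have D_small: "d z w < inverse (real (Suc n))" if "z \<in> D c (Suc n)" "w \<in> D c (Suc n)" for c n z w
    using that small[OF pP] unfolding D_def by blast
  have D_anti: "m \<le> n \<Longrightarrow> D c n \<subseteq> D c m" for c m n
    by (rule lift_Suc_antimono_le[where f = "D c"]) (use DD' D'D in blast)+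
  have "\<exists>z. \<forall>n. z \<in> D c n" for c
  proof -
    define C where "C n = D' c (Suc n)" for n
    have "\<Inter>(range C) \<noteq> {}"
    proof (rule Md(2)[unfolded mcomplete_nest, rule_format], intro conjI allI impI)
      show "closedin mtopology (C n)" for n
        unfolding C_def D'_def using closedin_act_image[OF pG closedin_closure_of] Md(3) by simp
      show "C n \<noteq> {}" for n unfolding C_def using DD' U(2) unfolding D_def by blast
      show "decseq C" unfolding C_def by (rule decseq_SucI) (use DD' D'D in blast)
      fix \<epsilon> :: real assume "\<epsilon> > 0"
      then obtain n where n: "inverse (real (Suc n)) < \<epsilon>" using reals_Archimedean by blast
      obtain z where z: "z \<in> D c (Suc n)" unfolding D_def using U(2) by blast
      have "C (Suc n) \<subseteq> mcball z \<epsilon>"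
      proof
        fix w assume "w \<in> C (Suc n)"
        then have w: "w \<in> D c (Suc n)" unfolding C_def using D'D by blast
        then show "w \<in> mcball z \<epsilon>" using z D_small[OF z w] n DZ by fastforce
      qed
      then show "\<exists>n a. C n \<subseteq> mcball a \<epsilon>" by blast
    qed
    then obtain z where "\<And>n. z \<in> C n" by auto
    then have "z \<in> D c n" for n unfolding C_def by (rule subsetD[OF D'D])
    then show ?thesis by (intro exI allI)
  qed
  then obtain \<pi> where \<pi>: "\<And>c n. \<pi> c \<in> D c n" by metis
  have \<pi>Z: "\<pi> c \<in> topspace Z" for c unfolding tZ by (rule subsetD[OF DZ \<pi>])
  have unique: "z = w" if "\<And>n. z \<in> D c n" "\<And>n. w \<in> D c n" for c z w
  proof (rule ccontr)
    have zw: "z \<in> M" "w \<in> M" by (rule subsetD[OF DZ that(1)], rule subsetD[OF DZ that(2)])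
    assume "z \<noteq> w"
    then obtain n where n: "inverse (real (Suc n)) < d z w"
      using reals_Archimedean[of "d z w"] zw by auto
    then show False using D_small[of z c n w] that by fastforce
  qed
  have p_cong: "p c n = p c' n" if "\<And>i. i < n \<Longrightarrow> c i = c' i" for c c' n
    using that by (induction n) (auto simp: p0 pS)
  have cont: "continuous_map cantor_space Z \<pi>"
    unfolding continuous_map
  proof (intro conjI allI impI)
    show "\<pi> ` topspace cantor_space \<subseteq> topspace Z" by (intro image_subsetI \<pi>Z)
    fix V assume V: "openin Z V"
    have tc: "topspace cantor_space = UNIV" unfolding cantor_space_def by simp
    show "openin cantor_space {c \<in> topspace cantor_space. \<pi> c \<in> V}"
    proof (subst openin_subopen, intro ballI)
      fix c assume "c \<in> {c \<in> topspace cantor_space. \<pi> c \<in> V}"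
      then have "\<pi> c \<in> V" by blast
      then obtain r where r: "r > 0" "mball (\<pi> c) r \<subseteq> V"
        using V unfolding Md(3) openin_mtopology by blast
      obtain n where n: "inverse (real (Suc n)) < r" using reals_Archimedean[OF r(1)] by blast
      define T where "T = (\<Pi>\<^sub>E i\<in>UNIV. if i < Suc n then {c i} else UNIV)"
      have "{i. (if i < Suc n then {c i} else UNIV) \<noteq> (UNIV :: bool set)} \<subseteq> {..<Suc n}" by auto
      then have "openin cantor_space T"
        unfolding cantor_space_def T_def openin_PiE_gen by (auto intro: finite_subset)
      moreover have "c \<in> T" unfolding T_def by auto
      moreover have "T \<subseteq> {c \<in> topspace cantor_space. \<pi> c \<in> V}"
      proof
        fix c' assume "c' \<in> T"
        then have "c' i \<in> (if i < Suc n then {c i} else UNIV)" for i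
          unfolding T_def by (auto dest: PiE_mem[of _ _ _ i])
        then have "p c' (Suc n) = p c (Suc n)" by (intro p_cong) (metis singletonD)
        then have "\<pi> c' \<in> D c (Suc n)" using \<pi>[of c' "Suc n"] unfolding D_def by simp
        then have "\<pi> c' \<in> mball (\<pi> c) r"
          using D_small[OF \<pi>, of "\<pi> c'" c n] n \<pi>Z[of c] \<pi>Z[of c'] tZ by (simp add: \<pi>)
        then show "c' \<in> {c \<in> topspace cantor_space. \<pi> c \<in> V}" using r(2) tc by blast
      qed
      ultimately show "\<exists>T. openin cantor_space T \<and> c \<in> T \<and> T \<subseteq> {c \<in> topspace cantor_space. \<pi> c \<in> V}"
        by blast
    qed
  qed
  have homo: "(\<pi> c, \<pi> c') \<in> F" if "(c, c') \<in> E0" for c c'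
  proof -
    obtain n where n: "\<And>m. m \<ge> n \<Longrightarrow> c m = c' m" using \<open>(c, c') \<in> E0\<close> unfolding E0_def by auto
    \<comment> \<open>The common tail of \<open>c\<close> and \<open>c'\<close> cancels, so one element carries the sets of \<open>c\<close>
      to those of \<open>c'\<close>.\<close>
    define h where "h = p c' n \<otimes> inv (p c n)"
    have h: "h \<in> carrier G" unfolding h_def using pG by simp
    have hp: "h \<otimes> p c m = p c' m" if "m \<ge> n" for m
      using that
    proof (induction m rule: dec_induct)
      case base
      then show ?case unfolding h_def using pG by (simp add: m_assoc)
    next
      case (step m)
      then show ?case using n[of m] h pG g by (simp add: pS flip: m_assoc)
    qed
    have "\<phi> h (\<pi> c) \<in> D c' m" for m
    proof -
      \<comment> \<open>The identity \<open>hp\<close> holds only from \<open>n\<close> on; smaller levels follow because the sets decrease.\<close>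
      let ?m = "max m n"
      obtain u where u: "u \<in> U ?m" "\<pi> c = \<phi> (p c ?m) u" using \<pi>[of c ?m] unfolding D_def by blast
      then have "\<phi> h (\<pi> c) = \<phi> (p c' ?m) u"
        using act_mult[OF h pG[of c ?m], of u] UZ hp[of ?m] by fastforce
      then have "\<phi> h (\<pi> c) \<in> D c' ?m" unfolding D_def using u(1) by blast
      then show ?thesis using D_anti[of m ?m c'] by auto
    qed
    then have "\<phi> h (\<pi> c) = \<pi> c'" using unique \<pi> by blast
    then show ?thesis using F(3)[OF h \<pi>Z[of c]] by simp
  qed
  \<comment> \<open>The sets separated by \<open>sep\<close> are those for \<open>\<not> c n\<close> on the left and \<open>c' n\<close> on the right; symmetry
    of \<open>F\<close> covers the other order.\<close>
  have half: "(\<pi> c, \<pi> c') \<notin> F" if inf: "\<And>n. \<exists>m\<ge>n. \<not> c m \<and> c' m" for c c'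
  proof
    assume "(\<pi> c, \<pi> c') \<in> F"
    then have "(\<pi> c, \<pi> c') \<in> F \<inter> (topspace Z \<times> topspace Z)" using \<pi>Z by simp
    then obtain n where n: "(\<pi> c, \<pi> c') \<in> K n" using K(2) by blast
    obtain m where m: "m \<ge> n" "\<not> c m" "c' m" using inf by blast
    obtain u where u: "u \<in> U (Suc m)" "\<pi> c = \<phi> (p c m) u"
      using \<pi>[of c "Suc m"] m(2) unfolding D_def by (auto simp: pS)
    obtain v where v: "v \<in> U (Suc m)" "\<pi> c' = \<phi> (p c' m \<otimes> g m) v"
      using \<pi>[of c' "Suc m"] m(3) unfolding D_def by (auto simp: pS)
    have "(\<pi> c, \<pi> c') \<notin> L m" using sep[OF pP pP u(1) v(1)] u(2) v(2) by simp
    then show False using n m(1) unfolding L_def by blast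
  qed
  have "(c, c') \<in> E0" if "(\<pi> c, \<pi> c') \<in> F" for c c'
  proof (rule ccontr)
    assume "(c, c') \<notin> E0"
    then have ne: "\<exists>m\<ge>n. c m \<noteq> c' m" for n unfolding E0_def by blast
    have "(\<forall>n. \<exists>m\<ge>n. \<not> c m \<and> c' m) \<or> (\<forall>n. \<exists>m\<ge>n. \<not> c' m \<and> c m)"
    proof (rule ccontr)
      assume "\<not> ?thesis"
      then obtain n1 n2 where n: "\<And>m. m \<ge> n1 \<Longrightarrow> c m \<or> \<not> c' m" "\<And>m. m \<ge> n2 \<Longrightarrow> c' m \<or> \<not> c m"
        by blast
      obtain m where "m \<ge> max n1 n2" "c m \<noteq> c' m" using ne by blast
      then show False using n[of m] by auto
    qed
    then show False using half[of c c'] half[of c' c] that symD[OF F(1) that] by blast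
  qed
  then show thesis using that cont homo by blast
qed

end

section \<open>Wandering open sets in orbit closures\<close>

context acts_by_homeomorphisms
begin

lemma orbit_dense_in_closure:
  assumes x: "x \<in> topspace Z"
  defines "K \<equiv> Z closure_of (orbit G \<phi> x)"
  shows "x \<in> K" "orbit G \<phi> x \<subseteq> K" "subtopology Z K closure_of (orbit G \<phi> x) = topspace (subtopology Z K)"
proof -
  have "orbit G \<phi> x \<subseteq> topspace Z" unfolding orbit_def using act_closed x by blast
  then show sub: "orbit G \<phi> x \<subseteq> K" unfolding K_def by (rule closure_of_subset)
  have "x \<in> orbit G \<phi> x" unfolding orbit_def using act_one[OF x] by force
  then show "x \<in> K" using sub by blast
  have "K \<inter> orbit G \<phi> x = orbit G \<phi> x" using sub by blast
  then have "subtopology Z K closure_of (orbit G \<phi> x) = K"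
    unfolding closure_of_subtopology by (simp add: K_def)
  moreover have "K \<subseteq> topspace Z" unfolding K_def by (rule closure_of_subset_topspace)
  ultimately show "subtopology Z K closure_of (orbit G \<phi> x) = topspace (subtopology Z K)"
    by (simp add: inf.absorb2)
qed

text \<open>
  If all classes were meager in the closure of the orbit, then \<open>F\<close> would be meager in its square,
  and the eventual equality relation would reduce to \<open>F\<close>.
\<close>

lemma nonmeager_class:
  assumes Z: "polish_topology Z" and F: "equiv (topspace Z) F" "orbit_rel G (topspace Z) \<phi> \<subseteq> F"
    and uB: "aleph0_universally_Baire (prod_topology Z Z) F" and smooth: "smooth_rel Z F"
    and x0: "x0 \<in> topspace Z"
  defines "K \<equiv> Z closure_of (orbit G \<phi> x0)"
  obtains x where "x \<in> K" "\<not> meager_in (subtopology Z K) (F `` {x} \<inter> K)"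
proof (rule ccontr)
  assume no: "\<not> thesis"
  let ?Z = "subtopology Z K"
  have KZ: "K \<subseteq> topspace Z" unfolding K_def by (rule closure_of_subset_topspace)
  then have tK: "topspace ?Z = K" by (simp add: inf.absorb2)
  interpret K: acts_by_homeomorphisms G ?Z \<phi>
    by (rule act_restrict_invariant[OF KZ]) (use orbit_closure_invariant x0 in \<open>simp add: K_def\<close>)
  have Kp: "polish_topology ?Z"
    unfolding K_def by (rule polish_topology_closed_subspace[OF Z closedin_closure_of])
  then have Kc: "completely_metrizable_space ?Z" unfolding polish_topology_def by blast
  have "continuous_map (prod_topology ?Z ?Z) (prod_topology Z Z) (\<lambda>z. z)"
    unfolding subtopology_Times[symmetric] by (rule continuous_map_from_subtopology) simp
  then have "(\<lambda>z. z) \<in> measurable (borel_of (prod_topology ?Z ?Z)) (borel_of (prod_topology Z Z))"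
    by (rule continuous_map_measurable_borel_of)
  then have "Baire_property_in (prod_topology ?Z ?Z) ((\<lambda>z. z) -` F \<inter> topspace (prod_topology ?Z ?Z))"
    by (rule aleph0_universally_BaireD[OF uB polish_topology_prod[OF Kp Kp]])
  then have BP: "Baire_property_in (prod_topology ?Z ?Z) (F \<inter> (K \<times> K))"
    using tK by simp
  have "meager_in (prod_topology ?Z ?Z) (F \<inter> (K \<times> K))"
  proof (rule meager_in_prod_if_sections_meager[OF Kc Kc polish_topology_second_countable[OF Kp] BP])
    fix x assume "x \<in> topspace ?Z"
    then have "x \<in> K" "(F \<inter> (K \<times> K)) `` {x} = F `` {x} \<inter> K" using tK by auto
    then show "meager_in ?Z ((F \<inter> (K \<times> K)) `` {x})" using no that by auto
  qed
  then have meager: "meager_in (prod_topology ?Z ?Z) (F \<inter> (topspace ?Z \<times> topspace ?Z))"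
    using tK by simp
  have orb: "(x, \<phi> g x) \<in> F" if "g \<in> carrier G" "x \<in> topspace ?Z" for g x
    using F(2) that KZ unfolding orbit_rel_def orbit_def tK by auto
  obtain \<pi> where \<pi>: "continuous_map cantor_space ?Z \<pi>" "\<And>c d. (c, d) \<in> E0 \<longleftrightarrow> (\<pi> c, \<pi> d) \<in> F"
  proof (rule K.E0_reduces_to_meager[OF Kc _ _ _ _ orb meager])
    show "x0 \<in> topspace ?Z" "?Z closure_of orbit G \<phi> x0 = topspace ?Z"
      using orbit_dense_in_closure[OF x0] tK unfolding K_def by auto
    show "sym F" "trans F" using F(1) by (auto elim: equivE)
    fix \<pi>' assume "continuous_map cantor_space ?Z \<pi>'" "\<And>c d. (c, d) \<in> E0 \<longleftrightarrow> (\<pi>' c, \<pi>' d) \<in> F"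
    then show thesis by (rule that)
  qed
  have "continuous_map cantor_space Z \<pi>"
    using \<pi>(1) continuous_map_into_fulltopology by blast
  then have "\<pi> \<in> measurable (borel_of cantor_space) (borel_of Z)"
    by (rule continuous_map_measurable_borel_of)
  then show False using smooth \<pi>(2) unfolding smooth_rel_def by blast
qed

text \<open>
  Some class \<open>C\<close> is nonmeager in the closure \<open>K\<close> of the orbit. Countably many translates of its
  wandering set \<open>Y\<close> cover \<open>C\<close>, so \<open>Y\<close> is comeager in a nonempty open subset \<open>U\<close> of \<open>K\<close>. If \<open>a U\<close> and
  \<open>b U\<close> meet, they do so in an open set in which \<open>a Y\<close> and \<open>b Y\<close> are both comeager, so disjointness
  passes from the translates of \<open>Y\<close> to those of \<open>U\<close>. The property is stated for an open set of the
  whole space, which is what makes it a condition on basic open sets.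
\<close>

lemma wandering_open_in_orbit_closure:
  assumes Z: "polish_topology Z" and F: "equiv (topspace Z) F" "orbit_rel G (topspace Z) \<phi> \<subseteq> F"
    and uB: "aleph0_universally_Baire (prod_topology Z Z) F" and smooth: "smooth_rel Z F"
    and \<S>: "\<And>S. S \<in> \<S> \<Longrightarrow> S \<subseteq> carrier G"
    and Y: "\<And>x. x \<in> topspace Z \<Longrightarrow> \<exists>Y. aleph0_universally_Baire (subtopology Z (F `` {x})) Y \<and>
      sigma_complete G \<phi> (F `` {x}) Y \<and> (\<forall>S\<in>\<S>. wandering \<phi> S Y)"
    and x0: "x0 \<in> topspace Z"
  defines "K \<equiv> Z closure_of (orbit G \<phi> x0)"
  obtains V where "openin Z V" "V \<inter> orbit G \<phi> x0 \<noteq> {}"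
    "\<And>S a b. S \<in> \<S> \<Longrightarrow> a \<in> S \<Longrightarrow> b \<in> S \<Longrightarrow> a \<noteq> b \<Longrightarrow> \<phi> a ` V \<inter> \<phi> b ` V \<inter> K = {}"
proof -
  let ?Z = "subtopology Z K"
  have KZ: "K \<subseteq> topspace Z" unfolding K_def by (rule closure_of_subset_topspace)
  then have tK: "topspace ?Z = K" by (simp add: inf.absorb2)
  have K_inv: "\<phi> g y \<in> K" if "g \<in> carrier G" "y \<in> K" for g y
    using orbit_closure_invariant x0 that unfolding K_def by simp
  interpret K: acts_by_homeomorphisms G ?Z \<phi>
    by (rule act_restrict_invariant[OF KZ K_inv])
  have Kp: "polish_topology ?Z"
    unfolding K_def by (rule polish_topology_closed_subspace[OF Z closedin_closure_of])
  then have Kc: "completely_metrizable_space ?Z" unfolding polish_topology_def by blast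
  obtain x where x: "x \<in> K" "\<not> meager_in ?Z (F `` {x} \<inter> K)"
    using nonmeager_class[OF Z F uB smooth x0] unfolding K_def by metis
  have xZ: "x \<in> topspace Z" using x(1) KZ by blast
  define C where "C = F `` {x}"
  have CZ: "C \<subseteq> topspace Z" unfolding C_def using equiv_class_subset F(1) by (metis equiv_type Image_subset)
  have C_inv: "\<phi> g y \<in> C" if "g \<in> carrier G" "y \<in> C" for g y
  proof -
    have "(y, \<phi> g y) \<in> F" using F(2) that CZ unfolding orbit_rel_def orbit_def by auto
    then show ?thesis using that(2) F(1) unfolding C_def equiv_def by (auto elim: transE)
  qed
  interpret C: acts_by_homeomorphisms G "subtopology Z C" \<phi>
    by (rule act_restrict_invariant[OF CZ C_inv])
  have "continuous_map ?Z (prod_topology Z Z) (\<lambda>z. (x, z))"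
    using xZ by (simp add: continuous_map_pairwise o_def continuous_map_from_subtopology)
  then have "(\<lambda>z. (x, z)) \<in> measurable (borel_of ?Z) (borel_of (prod_topology Z Z))"
    by (rule continuous_map_measurable_borel_of)
  then have "Baire_property_in ?Z ((\<lambda>z. (x, z)) -` F \<inter> topspace ?Z)"
    by (rule aleph0_universally_BaireD[OF uB Kp])
  moreover have "(\<lambda>z. (x, z)) -` F \<inter> topspace ?Z = C \<inter> K" unfolding C_def tK by auto
  ultimately obtain U where U: "openin ?Z U" "U \<noteq> {}" "meager_in ?Z (U - C \<inter> K)"
    using x(2) nonmeager_Baire_property_in[of ?Z "C \<inter> K"] unfolding C_def by metis
  obtain N :: "nat \<Rightarrow> 'x set" where N: "\<And>n. closedin ?Z (N n)" "\<And>n. ?Z interior_of (N n) = {}"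
    "U - C \<inter> K \<subseteq> (\<Union>n. N n)"
    using U(3) unfolding meager_in_iff_subset_closed by blast
  \<comment> \<open>\<open>Y\<close> is universally Baire only as a subset of \<open>C\<close>, and \<open>C \<inter> K\<close> need not be Polish. It is therefore
    pulled back along a Borel map from \<open>K\<close> to \<open>C\<close> that is the identity on a nonmeager Borel set \<open>P \<subseteq> C \<inter> K\<close>.\<close>
  define P where "P = U - (\<Union>n. N n)"
  have PC: "P \<subseteq> C" "P \<subseteq> K" using N(3) openin_subset[OF U(1)] tK unfolding P_def by auto
  have Pb: "P \<in> sets (borel_of ?Z)"
    unfolding P_def using closedin_in_sets_borel_of[OF N(1)] openin_in_sets_borel_of[OF U(1)]
    by (intro sets.Diff sets.countable_UN) auto
  have "\<not> meager_in ?Z P"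
  proof
    assume "meager_in ?Z P"
    moreover have "meager_in ?Z (\<Union>n. N n)"
      by (intro meager_in_UN_nat meager_in_nowhere_dense_closed N(1,2))
    ultimately have "meager_in ?Z (P \<union> (\<Union>n. N n))" by (rule meager_in_Un)
    then have "meager_in ?Z U" by (rule meager_in_mono) (auto simp: P_def)
    then show False using open_meager_in_empty[OF Kc U(1)] U(2) by blast
  qed
  then obtain c where c: "c \<in> P" using meager_in_empty by fastforce
  define f where "f z = (if z \<in> P then z else c)" for z
  have fC: "f z \<in> C" for z unfolding f_def using c PC by auto
  have f: "f \<in> measurable (borel_of ?Z) (borel_of (subtopology Z C))"
    unfolding borel_of_def[of "subtopology Z C"]
  proof (rule measurable_measure_of)
    show "{U. openin (subtopology Z C) U} \<subseteq> Pow (topspace (subtopology Z C))"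
      using openin_subset[of "subtopology Z C"] by blast
    show "f \<in> space (borel_of ?Z) \<rightarrow> topspace (subtopology Z C)" using fC CZ by auto
    fix V assume "V \<in> {U. openin (subtopology Z C) U}"
    then obtain V' where V': "openin Z V'" "V = V' \<inter> C" unfolding openin_subtopology by blast
    have VK: "V' \<inter> K \<in> sets (borel_of ?Z)"
      by (rule openin_in_sets_borel_of) (use V'(1) in \<open>auto simp: openin_subtopology\<close>)
    have cP: "(if c \<in> V' then space (borel_of ?Z) - P else {}) \<in> sets (borel_of ?Z)"
      using sets.compl_sets[OF Pb] by simp
    have "f -` V \<inter> space (borel_of ?Z) =
        ((V' \<inter> K) \<inter> P) \<union> (if c \<in> V' then space (borel_of ?Z) - P else {})"
      unfolding f_def V'(2) using PC c tK by (auto split: if_splits)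
    then show "f -` V \<inter> space (borel_of ?Z) \<in> sets (borel_of ?Z)"
      using sets.Un[OF sets.Int[OF VK Pb] cP] by simp
  qed
  obtain Y H where uBY: "aleph0_universally_Baire (subtopology Z C) Y" and YC: "Y \<subseteq> C"
    and H: "H \<subseteq> carrier G" "countable H" "C = (\<Union>h\<in>H. \<phi> h ` Y)"
    and wander: "\<forall>S\<in>\<S>. wandering \<phi> S Y"
    using Y[OF xZ] unfolding C_def sigma_complete_def by (elim exE conjE) auto
  define B where "B h = ((\<lambda>z. \<phi> (inv h) (f z)) -` Y \<inter> K) \<inter> P" for h
  have B: "Baire_property_in ?Z (B h)" if "h \<in> H" for h
  proof -
    have "continuous_map (subtopology Z C) (subtopology Z C) (\<phi> (inv h))"
      by (rule C.continuous) (use H that in auto)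
    from measurable_compose[OF f continuous_map_measurable_borel_of[OF this]]
    have "Baire_property_in ?Z ((\<lambda>z. \<phi> (inv h) (f z)) -` Y \<inter> topspace ?Z)"
      by (rule aleph0_universally_BaireD[OF uBY Kp])
    then show ?thesis unfolding B_def tK using Pb Baire_property_in_borel Baire_property_in_Int by blast
  qed
  have "P \<subseteq> (\<Union>h\<in>H. B h)"
  proof
    fix z assume z: "z \<in> P"
    then obtain h y where hy: "h \<in> H" "y \<in> Y" "z = \<phi> h y" using PC H(3) by blast
    then have "\<phi> (inv h) z = y" using act_inv(1)[of h y] H(1) YC CZ by auto
    then have "z \<in> B h" unfolding B_def f_def using z hy PC by auto
    then show "z \<in> (\<Union>h\<in>H. B h)" using hy by blast
  qed
  then have "\<not> meager_in ?Z (\<Union>h\<in>H. B h)" using \<open>\<not> meager_in ?Z P\<close> meager_in_mono by blast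
  then obtain h where h: "h \<in> H" "\<not> meager_in ?Z (B h)"
    using meager_in_UN[OF H(2), of ?Z B] by blast
  then obtain U' where U': "openin ?Z U'" "U' \<noteq> {}" "meager_in ?Z (U' - B h)"
    using nonmeager_Baire_property_in[OF B] by metis
  have hG: "h \<in> carrier G" "inv h \<in> carrier G" using h(1) H(1) by auto
  define U2 where "U2 = \<phi> (inv h) ` U'"
  have U2: "openin ?Z U2" "U2 \<noteq> {}" unfolding U2_def using K.openin_act_image hG U' by auto
  have "U2 - Y \<subseteq> \<phi> (inv h) ` (U' - B h)"
    unfolding U2_def B_def f_def by auto
  then have mU2: "meager_in ?Z (U2 - Y)"
    using meager_in_homeomorphic_image[OF K.homeomorphic_map_act[OF hG(2)] U'(3)] meager_in_mono by blast
  obtain V where V: "openin Z V" "U2 = V \<inter> K" using U2(1) unfolding openin_subtopology by blast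
  show thesis
  proof (rule that[OF V(1)])
    have "U2 \<inter> orbit G \<phi> x0 \<noteq> {}"
      using openin_Int_closure_of_eq_empty[OF U2(1), of "orbit G \<phi> x0"] orbit_dense_in_closure(3)[OF x0]
        U2 openin_subset[OF U2(1)] unfolding K_def[symmetric] by auto
    then show "V \<inter> orbit G \<phi> x0 \<noteq> {}" unfolding V(2) by blast
    fix S a b assume S: "S \<in> \<S>" and ab: "a \<in> S" "b \<in> S" "a \<noteq> b"
    have G: "a \<in> carrier G" "b \<in> carrier G" using \<S>[OF S] ab by auto
    have img: "\<phi> g ` V \<inter> K \<subseteq> \<phi> g ` U2" if g: "g \<in> carrier G" for g
    proof
      fix z assume z: "z \<in> \<phi> g ` V \<inter> K"
      then obtain v where v: "v \<in> V" "z = \<phi> g v" by blast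
      then have "v = \<phi> (inv g) z" using act_inv(1)[OF g] openin_subset[OF V(1)] by auto
      then have "v \<in> K" using K_inv[of "inv g" z] g z by auto
      then show "z \<in> \<phi> g ` U2" using v V(2) by blast
    qed
    let ?I = "\<phi> a ` U2 \<inter> \<phi> b ` U2"
    have "\<phi> a ` Y \<inter> \<phi> b ` Y = {}" using bspec[OF wander S] ab unfolding wandering_def by blast
    then have "?I \<subseteq> \<phi> a ` (U2 - Y) \<union> \<phi> b ` (U2 - Y)" by blast
    moreover have "meager_in ?Z (\<phi> a ` (U2 - Y) \<union> \<phi> b ` (U2 - Y))"
      using meager_in_homeomorphic_image[OF K.homeomorphic_map_act mU2] G by (intro meager_in_Un) auto
    ultimately have "meager_in ?Z ?I" by (rule meager_in_mono[rotated])
    moreover have "openin ?Z ?I" using K.openin_act_image U2(1) G by (intro openin_Int) auto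
    ultimately have "?I = {}" using open_meager_in_empty[OF Kc] by blast
    then show "\<phi> a ` V \<inter> \<phi> b ` V \<inter> K = {}" using img[OF G(1)] img[OF G(2)] by blast
  qed
qed

end

section \<open>Assembling wandering sets\<close>

context acts_by_homeomorphisms
begin

definition saturation :: "'x set \<Rightarrow> 'x set" where
  "saturation A = (\<Union>g\<in>carrier G. \<phi> g ` A)"

lemma openin_saturation: "openin Z A \<Longrightarrow> openin Z (saturation A)"
  unfolding saturation_def using openin_act_image by blast

lemma subset_saturation: "A \<subseteq> topspace Z \<Longrightarrow> A \<subseteq> saturation A"
  unfolding saturation_def using act_one by force

lemma act_in_saturation_iff:
  assumes A: "A \<subseteq> topspace Z" and g: "g \<in> carrier G" and x: "x \<in> topspace Z"
  shows "\<phi> g x \<in> saturation A \<longleftrightarrow> x \<in> saturation A"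
proof -
  have mono: "\<phi> k y \<in> saturation A" if k: "k \<in> carrier G" and y: "y \<in> saturation A" for k y
  proof -
    obtain h a where h: "h \<in> carrier G" "a \<in> A" "y = \<phi> h a" using y unfolding saturation_def by blast
    then have "\<phi> k y = \<phi> (k \<otimes> h) a" using act_mult k A by auto
    then show ?thesis unfolding saturation_def using h k by blast
  qed
  show ?thesis
  proof
    assume "\<phi> g x \<in> saturation A"
    then have "\<phi> (inv g) (\<phi> g x) \<in> saturation A" using mono g by blast
    then show "x \<in> saturation A" using act_inv(1)[OF g x] by simp
  qed (rule mono[OF g])
qed

text \<open>
  For a basic open set \<open>V k\<close> let \<open>W k\<close> be the saturation of all intersections of two translates of
  \<open>V k\<close> by distinct elements of a member of \<open>\<S>\<close>. Then \<open>V k - W k\<close> is a difference of open sets whose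
  translates by such elements are disjoint, and it consists of the points of \<open>V k\<close> along whose orbit \<open>V k\<close>
  behaves as the hypothesis demands. So the saturations \<open>X k\<close> of these sets cover the space. To form
  their union without creating new intersections, \<open>V k - W k\<close> is restricted to the orbits that lie
  in no earlier \<open>X j\<close>: the pieces then lie in disjoint invariant sets. Countably many translations
  suffice because a point that can be moved into an open set can be moved there by an element of
  \<open>\<Gamma>\<close>.
\<close>

lemma sigma_complete_fsigma_wandering:
  assumes Z: "polish_topology Z" and \<Gamma>: "countable \<Gamma>" "\<Gamma> \<subseteq> carrier G"
    and dense: "\<And>V g x. openin Z V \<Longrightarrow> x \<in> topspace Z \<Longrightarrow> g \<in> carrier G \<Longrightarrow> \<phi> g x \<in> V \<Longrightarrow>
      \<exists>\<gamma>\<in>\<Gamma>. \<phi> \<gamma> x \<in> V"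
    and \<S>: "\<And>S. S \<in> \<S> \<Longrightarrow> S \<subseteq> carrier G"
    and local: "\<And>x. x \<in> topspace Z \<Longrightarrow> \<exists>V. openin Z V \<and> V \<inter> orbit G \<phi> x \<noteq> {} \<and>
      (\<forall>S\<in>\<S>. \<forall>a\<in>S. \<forall>b\<in>S. a \<noteq> b \<longrightarrow> \<phi> a ` V \<inter> \<phi> b ` V \<inter> orbit G \<phi> x = {})"
  obtains Y where "fsigma_in Z Y" "sigma_complete G \<phi> (topspace Z) Y"
    "\<And>S. S \<in> \<S> \<Longrightarrow> wandering \<phi> S Y"
proof -
  obtain \<B> where \<B>: "countable \<B>" "\<And>V. V \<in> \<B> \<Longrightarrow> openin Z V"
    "\<And>U y. openin Z U \<Longrightarrow> y \<in> U \<Longrightarrow> \<exists>V \<in> \<B>. y \<in> V \<and> V \<subseteq> U"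
    using polish_topology_second_countable[OF Z] unfolding second_countable_def by metis
  \<comment> \<open>The empty set is added because an enumeration needs a nonempty set.\<close>
  define V where "V = from_nat_into (insert {} \<B>)"
  have rV: "range V = insert {} \<B>" unfolding V_def using \<B>(1) by (intro range_from_nat_into) auto
  have V: "openin Z (V k)" for k
    using rangeI[of V k] \<B>(2) unfolding rV by auto
  have VZ: "V k \<subseteq> topspace Z" for k by (rule openin_subset[OF V])
  define I where "I k = (\<Union>S\<in>\<S>. \<Union>a\<in>S. \<Union>b\<in>S - {a}. \<phi> a ` V k \<inter> \<phi> b ` V k)" for k
  define W where "W k = saturation (I k)" for k
  have oI: "openin Z (I k)" for k
    unfolding I_def using \<S>
    by (auto intro!: openin_Union openin_Int openin_act_image V)
  then have IZ: "I k \<subseteq> topspace Z" for k by (rule openin_subset)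
  have oW: "openin Z (W k)" for k unfolding W_def by (rule openin_saturation[OF oI])
  define X where "X k = saturation (V k) - W k" for k
  have X_iff: "\<phi> g x \<in> X k \<longleftrightarrow> x \<in> X k" if "g \<in> carrier G" "x \<in> topspace Z" for g x k
    unfolding X_def W_def using act_in_saturation_iff[OF VZ that] act_in_saturation_iff[OF IZ that] by simp
  define A where "A k = V k - W k - (\<Union>j<k. X j)" for k
  have AX: "A k \<subseteq> X k" for k unfolding A_def X_def using subset_saturation[OF VZ] by blast
  have AZ: "A k \<subseteq> topspace Z" for k unfolding A_def using VZ by blast
  define Y where "Y = (\<Union>k. A k)"
  have metr: "metrizable_space Z"
    using Z completely_metrizable_imp_metrizable_space unfolding polish_topology_def by blast
  have fs: "fsigma_in Z U" if "openin Z U" for U using open_imp_fsigma_in[OF metr that] .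
  have X_gd: "gdelta_in Z (X k)" for k
    unfolding X_def by (intro gdelta_in_diff fs oW open_imp_gdelta_in openin_saturation V)
  have gd: "gdelta_in Z (\<Union>j<k. X j)" for k :: nat
    by (induction k) (auto simp: lessThan_Suc intro!: gdelta_in_Un X_gd)
  have "fsigma_in Z (A k)" for k
    unfolding A_def
    by (rule fsigma_in_diff[OF fsigma_in_diff[OF fs[OF V] open_imp_gdelta_in[OF oW]] gd])
  then have "fsigma_in Z Y" unfolding Y_def by (intro fsigma_in_Union) auto
  moreover have "sigma_complete G \<phi> (topspace Z) Y"
    unfolding sigma_complete_def
  proof (intro conjI exI)
    show "Y \<subseteq> topspace Z" unfolding Y_def using AZ by blast
    show "m_inv G ` \<Gamma> \<subseteq> carrier G" "countable (m_inv G ` \<Gamma>)" using \<Gamma> by auto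
    show "topspace Z = (\<Union>h\<in>m_inv G ` \<Gamma>. \<phi> h ` Y)"
    proof (intro equalityI subsetI)
      fix x assume "x \<in> (\<Union>h\<in>m_inv G ` \<Gamma>. \<phi> h ` Y)"
      then show "x \<in> topspace Z" using \<Gamma>(2) act_closed AZ unfolding Y_def by blast
    next
      fix x assume x: "x \<in> topspace Z"
      obtain U where U: "openin Z U" "U \<inter> orbit G \<phi> x \<noteq> {}"
        "\<forall>S\<in>\<S>. \<forall>a\<in>S. \<forall>b\<in>S. a \<noteq> b \<longrightarrow> \<phi> a ` U \<inter> \<phi> b ` U \<inter> orbit G \<phi> x = {}"
        using local[OF x] by blast
      then obtain g where g: "g \<in> carrier G" "\<phi> g x \<in> U" unfolding orbit_def by blast
      then obtain B where "B \<in> \<B>" "\<phi> g x \<in> B" "B \<subseteq> U" using \<B>(3) U(1) by blast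
      then obtain k where k: "\<phi> g x \<in> V k" "V k \<subseteq> U" using rV by (metis insertI2 rangeE)
      have "x \<notin> W k"
      proof
        assume "x \<in> W k"
        then obtain h w where h: "h \<in> carrier G" "x = \<phi> h w" "w \<in> I k"
          unfolding W_def saturation_def by blast
        then obtain S a b where S: "S \<in> \<S>" "a \<in> S" "b \<in> S" "a \<noteq> b" "w \<in> \<phi> a ` V k \<inter> \<phi> b ` V k"
          unfolding I_def by auto
        have "w = \<phi> (inv h) x" using h act_inv(1)[OF h(1) subsetD[OF IZ h(3)]] by simp
        then have "w \<in> orbit G \<phi> x" unfolding orbit_def using h(1) by blast
        then have "w \<in> \<phi> a ` U \<inter> \<phi> b ` U \<inter> orbit G \<phi> x" using S(5) k(2) by blast
        then show False using U(3) S by blast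
      qed
      moreover have "x \<in> saturation (V k)"
        using act_in_saturation_iff[OF VZ g(1) x] subset_saturation[OF VZ] k(1) by blast
      ultimately have ex: "x \<in> X k" unfolding X_def by blast
      define m where "m = (LEAST j. x \<in> X j)"
      have m: "x \<in> X m" unfolding m_def using ex by (rule LeastI)
      have min: "x \<notin> X j" if "j < m" for j using that unfolding m_def by (rule not_less_Least)
      obtain h v where h: "h \<in> carrier G" "v \<in> V m" "x = \<phi> h v"
        using m unfolding X_def saturation_def by blast
      then have "\<phi> (inv h) x \<in> V m" using act_inv(1)[OF h(1) subsetD[OF VZ h(2)]] by simp
      then obtain \<gamma> where \<gamma>: "\<gamma> \<in> \<Gamma>" "\<phi> \<gamma> x \<in> V m" using dense[OF V x] h(1) by blast
      have \<gamma>G: "\<gamma> \<in> carrier G" using \<gamma> \<Gamma> by blast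
      have "\<phi> \<gamma> x \<in> X m" "\<And>j. j < m \<Longrightarrow> \<phi> \<gamma> x \<notin> X j"
        using X_iff[OF \<gamma>G x] m min by auto
      then have "\<phi> \<gamma> x \<in> A m" using \<gamma>(2) unfolding A_def X_def by auto
      then have "\<phi> \<gamma> x \<in> Y" unfolding Y_def by blast
      then have "\<phi> (inv \<gamma>) (\<phi> \<gamma> x) \<in> (\<Union>h\<in>m_inv G ` \<Gamma>. \<phi> h ` Y)" using \<gamma>(1) by blast
      then show "x \<in> (\<Union>h\<in>m_inv G ` \<Gamma>. \<phi> h ` Y)" using act_inv(1)[OF \<gamma>G x] by simp
    qed
  qed
  moreover have "wandering \<phi> S Y" if S: "S \<in> \<S>" for S
    unfolding wandering_def
  proof (intro ballI impI equals0I)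
    fix a b z assume ab: "a \<in> S" "b \<in> S" "a \<noteq> b" and z: "z \<in> \<phi> a ` Y \<inter> \<phi> b ` Y"
    have G: "a \<in> carrier G" "b \<in> carrier G" using \<S>[OF S] ab by auto
    obtain j k u v where uv: "u \<in> A j" "v \<in> A k" "z = \<phi> a u" "z = \<phi> b v"
      using z unfolding Y_def by blast
    have uvZ: "u \<in> topspace Z" "v \<in> topspace Z" using uv AZ by blast+
    have "u \<in> X i \<longleftrightarrow> v \<in> X i" for i
      using X_iff[OF G(1) uvZ(1), of i] X_iff[OF G(2) uvZ(2), of i] uv(3,4) by simp
    moreover have "u \<in> X j" "\<And>i. i < j \<Longrightarrow> u \<notin> X i" "v \<in> X k" "\<And>i. i < k \<Longrightarrow> v \<notin> X i"
      using uv(1,2) AX unfolding A_def by blast+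
    ultimately have jk: "j = k" by (metis linorder_neqE_nat)
    have "z \<in> \<phi> a ` V j \<inter> \<phi> b ` V j" using uv jk unfolding A_def by blast
    then have "z \<in> I j" unfolding I_def using S ab by auto
    then have "\<phi> a u \<in> W j" unfolding W_def using subset_saturation[OF IZ] uv(3) by blast
    then have "u \<in> W j" unfolding W_def using act_in_saturation_iff[OF IZ G(1) uvZ(1)] by simp
    then show False using uv(1) unfolding A_def by blast
  qed
  ultimately show thesis using that by blast
qed

end

section \<open>Continuous actions of separable groups\<close>

lemma continuous_action_acts_by_homeomorphisms:
  assumes "topological_group G T" "continuous_action G T X \<phi>"
  shows "acts_by_homeomorphisms G X \<phi>"
proof -
  interpret group G using assms(1) unfolding topological_group_def by blast
  interpret group_action G "topspace X" \<phi> using assms(2) unfolding continuous_action_def by blast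
  have tT: "topspace T = carrier G" using assms(1) unfolding topological_group_def by blast
  show ?thesis
  proof
    fix g assume g: "g \<in> carrier G"
    have "continuous_map X (prod_topology T X) (\<lambda>x. (g, x))"
      using g tT by (simp add: continuous_map_pairwise o_def)
    moreover have "continuous_map (prod_topology T X) X (\<lambda>(g, x). \<phi> g x)"
      using assms(2) unfolding continuous_action_def by blast
    ultimately have "continuous_map X X ((\<lambda>(g, x). \<phi> g x) \<circ> (\<lambda>x. (g, x)))"
      by (rule continuous_map_compose)
    then show "continuous_map X X (\<phi> g)" by (simp add: o_def)
  next
    fix x assume "x \<in> topspace X"
    then show "\<phi> \<one>\<^bsub>G\<^esub> x = x" using id_eq_one by (metis restrict_apply')
  qed (rule composition_rule)
qed

text \<open>
  The set of elements moving \<open>x\<close> into an open set is open in the group, so it meets a dense set.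
\<close>

lemma separable_group_countable_dense:
  assumes G: "topological_group G T" "separable_space T" and act: "continuous_action G T X \<phi>"
  obtains \<Gamma> where "countable \<Gamma>" "\<Gamma> \<subseteq> carrier G"
    "\<And>V g x. openin X V \<Longrightarrow> x \<in> topspace X \<Longrightarrow> g \<in> carrier G \<Longrightarrow> \<phi> g x \<in> V \<Longrightarrow> \<exists>\<gamma>\<in>\<Gamma>. \<phi> \<gamma> x \<in> V"
proof -
  have tT: "topspace T = carrier G" using G(1) unfolding topological_group_def by blast
  obtain \<Gamma> where \<Gamma>: "countable \<Gamma>" "\<Gamma> \<subseteq> carrier G" "T closure_of \<Gamma> = carrier G"
    using G(2) unfolding separable_space_def tT by blast
  show thesis
  proof (rule that[OF \<Gamma>(1,2)])
    fix V g x assume V: "openin X V" and x: "x \<in> topspace X" and g: "g \<in> carrier G" "\<phi> g x \<in> V"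
    have "continuous_map T (prod_topology T X) (\<lambda>g. (g, x))"
      using x by (simp add: continuous_map_pairwise o_def)
    moreover have "continuous_map (prod_topology T X) X (\<lambda>(g, x). \<phi> g x)"
      using act unfolding continuous_action_def by blast
    ultimately have "continuous_map T X ((\<lambda>(g, x). \<phi> g x) \<circ> (\<lambda>g. (g, x)))"
      by (rule continuous_map_compose)
    then have "openin T {g \<in> topspace T. \<phi> g x \<in> V}"
      using openin_continuous_map_preimage V by (fastforce simp: o_def)
    then have "{g \<in> topspace T. \<phi> g x \<in> V} \<inter> \<Gamma> \<noteq> {}"
      using openin_Int_closure_of_eq_empty[of T _ \<Gamma>] \<Gamma>(3) g tT by auto
    then show "\<exists>\<gamma>\<in>\<Gamma>. \<phi> \<gamma> x \<in> V" by blast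
  qed
qed

section \<open>Recurrence and wandering sets\<close>

text \<open>
  If \<open>a Y\<close> meets \<open>b Y\<close>, then \<open>Y\<close> meets its translate by the difference \<open>inv a \<otimes> b\<close>. This and the
  converse below translate between failure of recurrence and wandering sets.
\<close>

lemma (in acts_by_homeomorphisms) Delta_disjoint_imp_wandering:
  assumes Y: "Y \<subseteq> topspace Z" and S: "S \<subseteq> carrier G"
    and disj: "((set_inv S <#> S) - {\<one>}) \<inter> Delta G \<phi> Y = {}"
  shows "wandering \<phi> S Y"
  unfolding wandering_def
proof (intro ballI impI equals0I)
  fix a b z assume ab: "a \<in> S" "b \<in> S" "a \<noteq> b" and z: "z \<in> \<phi> a ` Y \<inter> \<phi> b ` Y"
  have G: "a \<in> carrier G" "b \<in> carrier G" using ab S by auto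
  obtain u v where uv: "u \<in> Y" "v \<in> Y" "\<phi> a u = \<phi> b v" using z by auto
  then have "\<phi> (inv a \<otimes> b) v = u" using act_mult act_inv(1) G Y by (metis inv_closed subsetD)
  then have "inv a \<otimes> b \<in> Delta G \<phi> Y" unfolding Delta_def using uv G by auto
  moreover have "inv a \<otimes> b \<noteq> \<one>" using ab G by (metis inv_closed inv_equality inv_inv)
  moreover have "inv a \<otimes> b \<in> set_inv S <#> S"
    unfolding set_mult_def SET_INV_def using ab by blast
  ultimately show False using disj by blast
qed

lemma (in acts_by_homeomorphisms) wandering_imp_Delta_disjoint:
  assumes Y: "Y \<subseteq> topspace Z" and S: "S \<subseteq> carrier G" and wander: "wandering \<phi> S Y"
  shows "((set_inv S <#> S) - {\<one>}) \<inter> Delta G \<phi> Y = {}"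
proof (rule equals0I)
  fix g assume g: "g \<in> ((set_inv S <#> S) - {\<one>}) \<inter> Delta G \<phi> Y"
  then obtain a b where ab: "a \<in> S" "b \<in> S" "g = inv a \<otimes> b"
    unfolding set_mult_def SET_INV_def by blast
  have G: "a \<in> carrier G" "b \<in> carrier G" using ab S by auto
  have "a \<noteq> b" using g ab G l_inv[of a] by auto
  obtain v where v: "v \<in> Y" "\<phi> (inv a \<otimes> b) v \<in> Y" using g ab unfolding Delta_def by blast
  then have "\<phi> a (\<phi> (inv a \<otimes> b) v) = \<phi> b v"
    using act_mult act_inv(2) act_closed G Y by (metis inv_closed subsetD)
  then have "\<phi> b v \<in> \<phi> a ` Y \<inter> \<phi> b ` Y" using v by (metis IntI imageI)
  then show False using wander ab \<open>a \<noteq> b\<close> unfolding wandering_def by blast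
qed

text \<open>
  A reduction to the relation with a single class would make all pairs eventually equal.
\<close>

lemma smooth_rel_full: "smooth_rel X (topspace X \<times> topspace X)"
  unfolding smooth_rel_def
proof clarify
  fix \<pi> assume \<pi>: "\<pi> \<in> measurable (borel_of cantor_space) (borel_of X)"
    and red: "\<forall>c d. (c, d) \<in> E0 \<longleftrightarrow> (\<pi> c, \<pi> d) \<in> topspace X \<times> topspace X"
  have "\<pi> c \<in> topspace X" for c
    using measurable_space[OF \<pi>, of c] by (simp add: cantor_space_def)
  then have "((\<lambda>_. True), (\<lambda>_. False)) \<in> E0" using red by blast
  then show False unfolding E0_def by auto
qed

lemma upward_closed_hitting_family: "upward_closed_family G (hitting_family G S)"
  unfolding upward_closed_family_def hitting_family_def by blast

theorem proposition3p5:
  fixes G :: "('g, 'm) monoid_scheme" and T :: "'g topology"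
    and X :: "'x topology" and \<phi> :: "'g \<Rightarrow> 'x \<Rightarrow> 'x"
  assumes "topological_group G T" and "separable_space T"
    and "polish_topology X"
    and "continuous_action G T X \<phi>"
  defines "stmt1 \<equiv> \<exists>S \<in> difference_sets G. hitting_family G S \<notin> recurrence_spectrum G X \<phi>"
    and "stmt2 \<equiv> \<exists>(S :: nat \<Rightarrow> 'g set) F.
           (\<forall>n. S n \<subseteq> carrier G \<and> finite (S n) \<and> card (S n) = n) \<and>
           superequivalence G (topspace X) \<phi> F \<and>
           aleph0_universally_Baire (prod_topology X X) F \<and> smooth_rel X F \<and>
           (\<forall>x \<in> topspace X. \<exists>Y.
              aleph0_universally_Baire (subtopology X (F `` {x})) Y \<and>
              sigma_complete G \<phi> (F `` {x}) Y \<and>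
              (\<forall>n. wandering \<phi> (S n) Y))"
    and "stmt3 \<equiv> \<exists>Y. fsigma_in X Y \<and> sigma_complete G \<phi> (topspace X) Y \<and>
           very_weakly_wandering G \<phi> Y"
  shows "(stmt1 \<longleftrightarrow> stmt2) \<and> (stmt2 \<longleftrightarrow> stmt3)"
proof -
  interpret acts_by_homeomorphisms G X \<phi>
    using assms(1,4) by (rule continuous_action_acts_by_homeomorphisms)
  have "stmt2" if s1: stmt1
  proof -
    obtain S where S: "S \<in> difference_sets G" "hitting_family G S \<notin> recurrence_spectrum G X \<phi>"
      using s1 unfolding stmt1_def by blast
    obtain s where s: "S = (\<Union>n. set_inv\<^bsub>G\<^esub> (s n) <#>\<^bsub>G\<^esub> s n) - {\<one>\<^bsub>G\<^esub>}"
      "\<And>n. s n \<subseteq> carrier G \<and> finite (s n) \<and> card (s n) = n"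
      using S(1) unfolding difference_sets_def by blast
    obtain F where F: "superequivalence G (topspace X) \<phi> F"
      "F \<in> sets (borel_of (prod_topology X X))" "smooth_rel X F"
      and not_rec: "\<And>C. C \<in> topspace X // F \<Longrightarrow> \<not> recurrent_on G \<phi> (hitting_family G S)
              {B \<in> sets (borel_of (subtopology X C)). sigma_complete G \<phi> C B}"
      using S(2) upward_closed_hitting_family unfolding recurrence_spectrum_def by blast
    have "\<exists>Y. aleph0_universally_Baire (subtopology X (F `` {x})) Y \<and>
              sigma_complete G \<phi> (F `` {x}) Y \<and> (\<forall>n. wandering \<phi> (s n) Y)"
      if x: "x \<in> topspace X" for x
    proof -
      obtain Y where Y: "Y \<in> sets (borel_of (subtopology X (F `` {x})))" "sigma_complete G \<phi> (F `` {x}) Y"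
        "Delta G \<phi> Y \<notin> hitting_family G S"
        using not_rec[OF quotientI[OF x]] unfolding recurrent_on_def by blast
      have "Y \<subseteq> topspace X" using sets.sets_into_space[OF Y(1)] by auto
      moreover have "S \<inter> Delta G \<phi> Y = {}"
        using Y(3) unfolding hitting_family_def Delta_def by blast
      ultimately have "wandering \<phi> (s n) Y" for n
        using s by (intro Delta_disjoint_imp_wandering) auto
      then show ?thesis using Y(1,2) aleph0_universally_Baire_borel by blast
    qed
    then show ?thesis unfolding stmt2_def using s(2) F aleph0_universally_Baire_borel by blast
  qed
  moreover have "stmt3" if s2: stmt2
  proof -
    obtain S F where S: "\<And>n. S n \<subseteq> carrier G \<and> finite (S n) \<and> card (S n) = n"
      and F: "superequivalence G (topspace X) \<phi> F" "aleph0_universally_Baire (prod_topology X X) F"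
        "smooth_rel X F"
      and Y: "\<And>x. x \<in> topspace X \<Longrightarrow> \<exists>Y. aleph0_universally_Baire (subtopology X (F `` {x})) Y \<and>
              sigma_complete G \<phi> (F `` {x}) Y \<and> (\<forall>n. wandering \<phi> (S n) Y)"
      using s2 unfolding stmt2_def by blast
    have F': "equiv (topspace X) F" "orbit_rel G (topspace X) \<phi> \<subseteq> F"
      using F(1) unfolding superequivalence_def by auto
    have SG: "S' \<subseteq> carrier G" if "S' \<in> range S" for S' using that S by blast
    have Y': "\<exists>Y. aleph0_universally_Baire (subtopology X (F `` {x})) Y \<and>
              sigma_complete G \<phi> (F `` {x}) Y \<and> (\<forall>S'\<in>range S. wandering \<phi> S' Y)"
      if "x \<in> topspace X" for x using Y[OF that] by blast
    obtain \<Gamma> where \<Gamma>: "countable \<Gamma>" "\<Gamma> \<subseteq> carrier G"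
      "\<And>V g x. openin X V \<Longrightarrow> x \<in> topspace X \<Longrightarrow> g \<in> carrier G \<Longrightarrow> \<phi> g x \<in> V \<Longrightarrow> \<exists>\<gamma>\<in>\<Gamma>. \<phi> \<gamma> x \<in> V"
      using separable_group_countable_dense[OF assms(1,2,4)] by metis
    have local: "\<exists>V. openin X V \<and> V \<inter> orbit G \<phi> x \<noteq> {} \<and>
      (\<forall>S'\<in>range S. \<forall>a\<in>S'. \<forall>b\<in>S'. a \<noteq> b \<longrightarrow> \<phi> a ` V \<inter> \<phi> b ` V \<inter> orbit G \<phi> x = {})"
      if x: "x \<in> topspace X" for x
    proof -
      obtain V where V: "openin X V" "V \<inter> orbit G \<phi> x \<noteq> {}"
        "\<And>S' a b. S' \<in> range S \<Longrightarrow> a \<in> S' \<Longrightarrow> b \<in> S' \<Longrightarrow> a \<noteq> b \<Longrightarrow>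
          \<phi> a ` V \<inter> \<phi> b ` V \<inter> X closure_of (orbit G \<phi> x) = {}"
        using wandering_open_in_orbit_closure[OF assms(3) F' F(2,3) SG Y' x] by blast
      have "orbit G \<phi> x \<subseteq> X closure_of (orbit G \<phi> x)" by (rule orbit_dense_in_closure(2)[OF x])
      then show ?thesis using V by (intro exI[of _ V]) blast
    qed
    obtain Y where "fsigma_in X Y" "sigma_complete G \<phi> (topspace X) Y"
      "\<And>S'. S' \<in> range S \<Longrightarrow> wandering \<phi> S' Y"
      by (rule sigma_complete_fsigma_wandering[OF assms(3) \<Gamma> SG local]) (assumption+, rule that)
    moreover have "very_weakly_wandering G \<phi> Y"
      unfolding very_weakly_wandering_def
    proof
      fix n
      show "\<exists>S\<subseteq>carrier G. finite S \<and> n \<le> card S \<and> wandering \<phi> S Y"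
        by (rule exI[of _ "S n"]) (use S[of n] calculation(3) in auto)
    qed
    ultimately show ?thesis unfolding stmt3_def by blast
  qed
  moreover have "stmt1" if s3: stmt3
  proof -
    obtain Y where Y: "fsigma_in X Y" "sigma_complete G \<phi> (topspace X) Y" "very_weakly_wandering G \<phi> Y"
      using s3 unfolding stmt3_def by blast
    have YX: "Y \<subseteq> topspace X" using Y(1) by (rule fsigma_in_subset)
    have "\<exists>S\<subseteq>carrier G. finite S \<and> card S = n \<and> wandering \<phi> S Y" for n
    proof -
      obtain S' where S': "S' \<subseteq> carrier G" "finite S'" "n \<le> card S'" "wandering \<phi> S' Y"
        using Y(3) unfolding very_weakly_wandering_def by blast
      obtain S where "S \<subseteq> S'" "card S = n" "finite S" using obtain_subset_with_card_n[OF S'(3)] by metis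
      then show ?thesis using S' unfolding wandering_def by (intro exI[of _ S]) blast
    qed
    then obtain s where s: "\<And>n. s n \<subseteq> carrier G" "\<And>n. finite (s n)" "\<And>n. card (s n) = n"
      "\<And>n. wandering \<phi> (s n) Y"
      by metis
    define S where "S = (\<Union>n. set_inv\<^bsub>G\<^esub> (s n) <#>\<^bsub>G\<^esub> s n) - {\<one>\<^bsub>G\<^esub>}"
    have "S \<in> difference_sets G" unfolding difference_sets_def S_def using s by blast
    moreover have "hitting_family G S \<notin> recurrence_spectrum G X \<phi>"
    proof
      assume "hitting_family G S \<in> recurrence_spectrum G X \<phi>"
      moreover have "superequivalence G (topspace X) \<phi> (topspace X \<times> topspace X)"
        unfolding superequivalence_def orbit_rel_def orbit_def
        using act_closed by (auto simp: equiv_def refl_on_def sym_def trans_def)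
      moreover have "topspace X \<times> topspace X \<in> sets (borel_of (prod_topology X X))"
        using openin_in_sets_borel_of[OF openin_topspace, of "prod_topology X X"] by simp
      ultimately obtain C where C: "C \<in> topspace X // (topspace X \<times> topspace X)"
        and rec: "recurrent_on G \<phi> (hitting_family G S)
              {B \<in> sets (borel_of (subtopology X C)). sigma_complete G \<phi> C B}"
        unfolding recurrence_spectrum_def using smooth_rel_full by blast
      have "C = topspace X" using C by (auto elim!: quotientE)
      moreover have "Y \<in> sets (borel_of X)" using Y(1) by (rule fsigma_in_in_sets_borel_of)
      ultimately have "Delta G \<phi> Y \<in> hitting_family G S"
        using rec Y(2) unfolding recurrent_on_def by simp
      then have "S \<inter> Delta G \<phi> Y \<noteq> {}" unfolding hitting_family_def by blast
      then show False
        using wandering_imp_Delta_disjoint[OF YX s(1) s(4)] unfolding S_def by blast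
    qed
    ultimately show ?thesis unfolding stmt1_def by blast
  qed
  ultimately show ?thesis by blast
qed

end
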